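(* Let $(X,\rho)$ be a complete metric space and let $(w,p)_N=(w_1,\dots,w_N,p_1,\dots,p_N)$ be an iterated function system on $X$ such that $$\sum_{i=1}^N p_i(x)\,\rho(w_i(x),w_i(y))\le r(\rho(x,y)),\qquad \sum_{i=1}^N|p_i(x)-p_i(y)|\le\omega(\rho(x,y))$$ for all $x,y\in X$ and a couple of concave functions $(r,\omega)\in\mathcal{R}$. Furthermore, suppose that there exist $\hat{x}\in X$ with $\min_{1\le i\le N}p_i(\hat{x})>0$ and $k\in\{1,\dots,N\}$ such that $w_k$ is a contraction and $\inf_{x\in X}p_k(x)>0$. Then the transition operator $$Pf(x)=\sum_{i=1}^N f(w_i(x))\,p_i(x)$$ corresponding to $(w,p)_N$ is asymptotically stable, and the measures $(P^{\ast})^n\delta_x(\cdot):=P^n\mathbf{1}_{(\cdot)}(x)$ converge weakly, as $n\to\infty$, to a unique $\mu_{\ast}\in\mathcal{M}_1(X)$ uniformly with respect to $x$ on compact subsets of $X$; that is, for every compact $K\subset X$ and every $\varphi\in C_b(X)$, $\lim_{n\to\infty}\sup_{x\in K}\left|P^n\varphi(x)-\int_X\varphi\,d\mu_{\ast}\right|=0$.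
   Context: $C_b(X)$ is the space of real bounded continuous functions on $X$; $\mathcal{M}_1(X)$ is the set of (countably additive) Borel probability measures on $X$; $\delta_x$ is the Dirac measure at $x$. An iterated function system $(w,p)_N$ on $X$ consists of continuous transformations $w_i:X\to X$ and continuous functions $p_i:X\to[0,1]$, $i=1,\dots,N$, with $\sum_{i=1}^Np_i(x)=1$ for all $x\in X$. $\mathcal{R}$ denotes the collection of all couples $(r,\omega)$ of functions $[0,\infty)\to[0,\infty)$ that are nondecreasing, continuous at $0$, with $r(0)=\omega(0)=0$, and for which there is some $T>0$ such that for every $0<t<T$ one has $r(t)<t$ and the series $\sum_{n=1}^\infty\omega(r^n(t))$ converges, where $r^n$ is the $n$-th iterate of $r$. The operator $P$ acts on bounded Borel functions on $X$; its dual $P^{\ast}:\mathcal{M}_1(X)\to\mathcal{M}_1(X)$ is given by $P^{\ast}\mu(A)=\int_X P\mathbf 1_A\,d\mu$ for Borel $A\subset X$. $P$ is asymptotically stable if there exists a unique $\mu_{\ast}\in\mathcal{M}_1(X)$ with $P^{\ast}\mu_{\ast}=\mu_{\ast}$, and $(P^{\ast})^n\mu$ converges weakly to $\mu_{\ast}$ (i.e. integrals of every $\varphi\in C_b(X)$ converge) as $n\to\infty$ for every $\mu\in\mathcal{M}_1(X)$. *)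

theory Defs
  imports "HOL-Probability.Probability"
begin

definition borel_prob :: "'a::topological_space measure set" where
  "borel_prob = {\<mu>. prob_space \<mu> \<and> sets \<mu> = sets borel}"

definition ifs :: "nat \<Rightarrow> (nat \<Rightarrow> 'a::metric_space \<Rightarrow> 'a) \<Rightarrow> (nat \<Rightarrow> 'a \<Rightarrow> real) \<Rightarrow> bool" where
  "ifs N w p \<longleftrightarrow>
     (\<forall>i\<in>{1..N}. continuous_on UNIV (w i)) \<and>
     (\<forall>i\<in>{1..N}. continuous_on UNIV (p i) \<and> (\<forall>x. p i x \<in> {0..1})) \<and>
     (\<forall>x. (\<Sum>i=1..N. p i x) = 1)"

definition trans_op ::
  "nat \<Rightarrow> (nat \<Rightarrow> 'a \<Rightarrow> 'a) \<Rightarrow> (nat \<Rightarrow> 'a \<Rightarrow> real) \<Rightarrow> ('a \<Rightarrow> real) \<Rightarrow> 'a \<Rightarrow> real" where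
  "trans_op N w p f x = (\<Sum>i=1..N. f (w i x) * p i x)"

text \<open>Functions on $[0,\infty)$ are represented by total functions on the reals; only
  their values on the half-line are constrained or used.\<close>

definition couples :: "((real \<Rightarrow> real) \<times> (real \<Rightarrow> real)) set" where
  "couples = {(r, \<omega>).
     (\<forall>t\<ge>0. 0 \<le> r t) \<and> (\<forall>t\<ge>0. 0 \<le> \<omega> t) \<and>
     mono_on {0..} r \<and> mono_on {0..} \<omega> \<and>
     continuous (at 0 within {0..}) r \<and> continuous (at 0 within {0..}) \<omega> \<and>
     r 0 = 0 \<and> \<omega> 0 = 0 \<and>
     (\<exists>T>0. \<forall>t. 0 < t \<and> t < T \<longrightarrow>
        r t < t \<and> summable (\<lambda>n. \<omega> ((r ^^ Suc n) t)))}"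

text \<open>The dual operator on measures. If the set function below is not a measure, the result
  is the null measure; lemma \<open>emeasure_dual_op\<close> shows that this does not happen for the
  transition operator of an iterated function system.\<close>

definition dual_op ::
  "(('a::topological_space \<Rightarrow> real) \<Rightarrow> 'a \<Rightarrow> real) \<Rightarrow> 'a measure \<Rightarrow> 'a measure" where
  "dual_op P \<mu> = measure_of UNIV (sets borel) (\<lambda>A. ennreal (\<integral>x. P (indicator A) x \<partial>\<mu>))"

definition weakly_converges ::
  "(nat \<Rightarrow> 'a::topological_space measure) \<Rightarrow> 'a measure \<Rightarrow> bool" where
  "weakly_converges M \<mu> \<longleftrightarrow>
     (\<forall>\<phi>\<in>bcontfun. (\<lambda>n. \<integral>x. (\<phi> x :: real) \<partial>M n) \<longlonglongrightarrow> (\<integral>x. \<phi> x \<partial>\<mu>))"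

definition asymptotically_stable ::
  "(('a::topological_space \<Rightarrow> real) \<Rightarrow> 'a \<Rightarrow> real) \<Rightarrow> bool" where
  "asymptotically_stable P \<longleftrightarrow>
     (\<exists>\<mu>\<^sub>s\<in>borel_prob. dual_op P \<mu>\<^sub>s = \<mu>\<^sub>s \<and>
        (\<forall>\<nu>\<in>borel_prob. dual_op P \<nu> = \<nu> \<longrightarrow> \<nu> = \<mu>\<^sub>s) \<and>
        (\<forall>\<mu>\<in>borel_prob. weakly_converges (\<lambda>n. (dual_op P ^^ n) \<mu>) \<mu>\<^sub>s))"

text \<open>Uniform weak convergence of the measures $(P^*)^n \delta_x$ on compact sets. The integral
  of $\varphi$ against $(P^*)^n \delta_x$ is $P^n\varphi(x)$, see \<open>integral_dual_op_funpow_return\<close>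
  below. The empty set is excluded because \<open>Sup {}\<close> is unspecified on the reals.\<close>

definition weakly_converges_unif_compacts ::
  "(('a::topological_space \<Rightarrow> real) \<Rightarrow> 'a \<Rightarrow> real) \<Rightarrow> 'a measure \<Rightarrow> bool" where
  "weakly_converges_unif_compacts P \<mu> \<longleftrightarrow>
     (\<forall>K. compact K \<and> K \<noteq> {} \<longrightarrow> (\<forall>\<phi>\<in>bcontfun.
        (\<lambda>n. SUP x\<in>K. \<bar>(P ^^ n) \<phi> x - (\<integral>y. \<phi> y \<partial>\<mu>)\<bar>) \<longlonglongrightarrow> 0))"

lemma trans_op_measurable:
  assumes "ifs N w p" "f \<in> borel_measurable borel"
  shows "trans_op N w p f \<in> borel_measurable borel"
proof -
  have "(\<lambda>x. \<Sum>i=1..N. f (w i x) * p i x) \<in> borel_measurable borel"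
  proof (rule borel_measurable_sum)
    fix i assume i: "i \<in> {1..N}"
    then have "w i \<in> borel_measurable borel" "p i \<in> borel_measurable borel"
      using assms(1) by (auto simp: ifs_def intro!: borel_measurable_continuous_onI)
    then show "(\<lambda>x. f (w i x) * p i x) \<in> borel_measurable borel"
      using assms(2) by (intro borel_measurable_times measurable_compose[OF _ assms(2)]) auto
  qed
  then show ?thesis by (simp add: trans_op_def[abs_def])
qed

lemma trans_op_abs_le:
  assumes "ifs N w p" "\<And>x. \<bar>f x\<bar> \<le> B"
  shows "\<bar>trans_op N w p f x\<bar> \<le> B"
proof -
  have "\<bar>trans_op N w p f x\<bar> \<le> (\<Sum>i=1..N. \<bar>f (w i x) * p i x\<bar>)"
    unfolding trans_op_def by (rule sum_abs)
  also have "\<dots> \<le> (\<Sum>i=1..N. B * p i x)"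
    using assms by (intro sum_mono) (auto simp: ifs_def abs_mult intro!: mult_right_mono)
  also have "\<dots> = B" using assms(1) by (simp add: ifs_def sum_distrib_left[symmetric])
  finally show ?thesis .
qed

lemma trans_op_nonneg:
  assumes "ifs N w p" "\<And>x. 0 \<le> f x"
  shows "0 \<le> trans_op N w p f x"
  using assms by (auto simp: ifs_def trans_op_def intro!: sum_nonneg)

lemma emeasure_dual_op_nn:
  assumes I: "ifs N w p" and mu: "\<mu> \<in> borel_prob" and A: "A \<in> sets borel"
  shows "ennreal (\<integral>x. trans_op N w p (indicator A) x \<partial>\<mu>)
    = (\<integral>\<^sup>+x. (\<Sum>i=1..N. ennreal (p i x) * indicator A (w i x)) \<partial>\<mu>)"
proof -
  interpret prob_space \<mu> using mu by (simp add: borel_prob_def)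
  have s: "sets \<mu> = sets borel" using mu by (simp add: borel_prob_def)
  have m: "trans_op N w p (indicator A) \<in> borel_measurable \<mu>"
    using trans_op_measurable[OF I, of "indicator A"] A by (simp cong: measurable_cong_sets[OF s refl])
  have b: "\<bar>trans_op N w p (indicator A) x\<bar> \<le> 1" for x
    by (rule trans_op_abs_le[OF I]) (auto simp: indicator_def)
  have "integrable \<mu> (trans_op N w p (indicator A))"
    by (rule integrable_const_bound[where B=1]) (use b m in auto)
  then have "ennreal (\<integral>x. trans_op N w p (indicator A) x \<partial>\<mu>)
      = (\<integral>\<^sup>+x. ennreal (trans_op N w p (indicator A) x) \<partial>\<mu>)"
    by (intro nn_integral_eq_integral[symmetric])
      (auto intro!: trans_op_nonneg[OF I])
  also have "\<dots> = (\<integral>\<^sup>+x. (\<Sum>i=1..N. ennreal (p i x) * indicator A (w i x)) \<partial>\<mu>)"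
  proof (rule nn_integral_cong)
    fix x
    have "ennreal (trans_op N w p (indicator A) x)
        = (\<Sum>i=1..N. ennreal (indicator A (w i x) * p i x))"
      unfolding trans_op_def using I by (subst sum_ennreal) (auto simp: ifs_def)
    also have "\<dots> = (\<Sum>i=1..N. ennreal (p i x) * indicator A (w i x))"
      by (rule sum.cong) (auto simp: indicator_def)
    finally show "ennreal (trans_op N w p (indicator A) x)
        = (\<Sum>i=1..N. ennreal (p i x) * indicator A (w i x))" .
  qed
  finally show ?thesis .
qed

lemma sets_dual_op [simp]: "sets (dual_op P \<mu>) = sets borel"
  unfolding dual_op_def
  by (metis sets.sigma_sets_eq sets_measure_of space_borel top_greatest Pow_UNIV)

lemma emeasure_dual_op:
  assumes I: "ifs N w p" and mu: "\<mu> \<in> borel_prob" and A: "A \<in> sets borel"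
  shows "emeasure (dual_op (trans_op N w p) \<mu>) A
    = ennreal (\<integral>x. trans_op N w p (indicator A) x \<partial>\<mu>)"
proof -
  have s: "sets \<mu> = sets borel" using mu by (simp add: borel_prob_def)
  have wm: "w i \<in> measurable \<mu> borel" and pm: "p i \<in> borel_measurable \<mu>" if "i \<in> {1..N}" for i
    using I that
    by (auto simp: ifs_def measurable_cong_sets[OF s refl] intro!: borel_measurable_continuous_onI)
  let ?g = "\<lambda>A. \<integral>\<^sup>+x. (\<Sum>i=1..N. ennreal (p i x) * indicator A (w i x)) \<partial>\<mu>"
  let ?f = "\<lambda>A. ennreal (\<integral>x. trans_op N w p (indicator A) x \<partial>\<mu>)"
  have ca: "countably_additive (sets borel) ?f"
  proof (rule countably_additiveI)
    fix B :: "nat \<Rightarrow> 'a set"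
    assume B: "range B \<subseteq> sets borel" "disjoint_family B" "(\<Union>i. B i) \<in> sets borel"
    have "(\<Sum>n. ?g (B n)) = (\<integral>\<^sup>+x. (\<Sum>n. \<Sum>i=1..N. ennreal (p i x) * indicator (B n) (w i x)) \<partial>\<mu>)"
    proof (rule nn_integral_suminf[symmetric])
      fix n
      have "B n \<in> sets borel" using B by auto
      then show "(\<lambda>x. \<Sum>i=1..N. ennreal (p i x) * indicator (B n) (w i x)) \<in> borel_measurable \<mu>"
        by (intro borel_measurable_sum borel_measurable_times_ennreal
              measurable_compose[OF pm measurable_ennreal]
              measurable_compose[OF wm borel_measurable_indicator]) auto
    qed
    also have "\<dots> = ?g (\<Union>n. B n)"
    proof (rule nn_integral_cong)
      fix x
      have "(\<Sum>n. \<Sum>i=1..N. ennreal (p i x) * indicator (B n) (w i x))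
         = (\<Sum>i=1..N. \<Sum>n. ennreal (p i x) * indicator (B n) (w i x))"
        by (rule suminf_sum) simp
      also have "\<dots> = (\<Sum>i=1..N. ennreal (p i x) * indicator (\<Union>n. B n) (w i x))"
        by (simp add: suminf_indicator[OF B(2)])
      finally show "(\<Sum>n. \<Sum>i=1..N. ennreal (p i x) * indicator (B n) (w i x))
         = (\<Sum>i=1..N. ennreal (p i x) * indicator (\<Union>n. B n) (w i x))" .
    qed
    finally show "(\<Sum>n. ?f (B n)) = ?f (\<Union>n. B n)"
      using B by (subst (1 2) emeasure_dual_op_nn[OF I mu]) auto
  qed
  show ?thesis
  proof (rule emeasure_measure_of[OF dual_op_def])
    show "positive (sets (dual_op (trans_op N w p) \<mu>)) ?f"
      by (simp add: positive_def trans_op_def)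
    show "countably_additive (sets (dual_op (trans_op N w p) \<mu>)) ?f" using ca by simp
  qed (use A in auto)
qed

lemma dual_op_borel_prob:
  assumes I: "ifs N w p" and mu: "\<mu> \<in> borel_prob"
  shows "dual_op (trans_op N w p) \<mu> \<in> borel_prob"
proof -
  interpret prob_space \<mu> using mu by (simp add: borel_prob_def)
  have sp: "space (dual_op (trans_op N w p) \<mu>) = UNIV"
    using sets_eq_imp_space_eq[OF sets_dual_op] by simp
  have "trans_op N w p (indicator UNIV) = (\<lambda>x. 1)"
    using I by (simp add: trans_op_def[abs_def] ifs_def)
  then have "emeasure (dual_op (trans_op N w p) \<mu>) UNIV = 1"
    by (subst emeasure_dual_op[OF I mu]) (simp_all add: prob_space)
  then show ?thesis by (auto simp: borel_prob_def sp intro!: prob_spaceI)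
qed

lemma nn_integral_dual_op:
  assumes I: "ifs N w p" and mu: "\<mu> \<in> borel_prob" and f: "f \<in> borel_measurable borel"
  shows "(\<integral>\<^sup>+x. f x \<partial>dual_op (trans_op N w p) \<mu>)
    = (\<integral>\<^sup>+x. (\<Sum>i=1..N. ennreal (p i x) * f (w i x)) \<partial>\<mu>)"
proof -
  have s: "sets \<mu> = sets borel" using mu by (simp add: borel_prob_def)
  have wm: "w i \<in> measurable \<mu> borel" and pm: "p i \<in> borel_measurable \<mu>" if "i \<in> {1..N}" for i
    using I that
    by (auto simp: ifs_def measurable_cong_sets[OF s refl] intro!: borel_measurable_continuous_onI)
  have gm: "(\<lambda>x. ennreal (p i x) * g (w i x)) \<in> borel_measurable \<mu>"
    if "g \<in> borel_measurable borel" "i \<in> {1..N}" for g i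
    by (intro borel_measurable_times_ennreal measurable_compose[OF pm measurable_ennreal]
          measurable_compose[OF wm] that)
  from f show ?thesis
  proof (induction f rule: borel_measurable_induct)
    case (cong f g)
    then show ?case by (simp add: space_borel)
  next
    case (set A)
    then show ?case
      by (simp add: emeasure_dual_op[OF I mu] emeasure_dual_op_nn[OF I mu])
  next
    case (mult u c)
    have "(\<integral>\<^sup>+x. (\<Sum>i=1..N. ennreal (p i x) * (c * u (w i x))) \<partial>\<mu>)
        = (\<integral>\<^sup>+x. c * (\<Sum>i=1..N. ennreal (p i x) * u (w i x)) \<partial>\<mu>)"
      by (simp add: sum_distrib_left mult.left_commute)
    also have "\<dots> = c * (\<integral>\<^sup>+x. (\<Sum>i=1..N. ennreal (p i x) * u (w i x)) \<partial>\<mu>)"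
      by (intro nn_integral_cmult borel_measurable_sum gm mult)
    finally show ?case
      using mult by (simp add: nn_integral_cmult cong: measurable_cong_sets)
  next
    case (add u v)
    have "(\<integral>\<^sup>+x. (\<Sum>i=1..N. ennreal (p i x) * (v (w i x) + u (w i x))) \<partial>\<mu>)
        = (\<integral>\<^sup>+x. (\<Sum>i=1..N. ennreal (p i x) * v (w i x)) + (\<Sum>i=1..N. ennreal (p i x) * u (w i x)) \<partial>\<mu>)"
      by (simp add: distrib_left sum.distrib)
    also have "\<dots> = (\<integral>\<^sup>+x. (\<Sum>i=1..N. ennreal (p i x) * v (w i x)) \<partial>\<mu>)
        + (\<integral>\<^sup>+x. (\<Sum>i=1..N. ennreal (p i x) * u (w i x)) \<partial>\<mu>)"
      by (intro nn_integral_add borel_measurable_sum gm add)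
    finally show ?case
      using add by (simp add: nn_integral_add cong: measurable_cong_sets)
  next
    case (seq U)
    let ?G = "\<lambda>n x. \<Sum>i=1..N. ennreal (p i x) * U n (w i x)"
    have inc: "incseq ?G"
      using seq(3) by (auto simp: incseq_def le_fun_def intro!: sum_mono mult_left_mono)
    have SU: "(\<Sum>i=1..N. ennreal (p i x) * (SUP n. U n) (w i x)) = (SUP n. ?G n x)" for x
    proof -
      have "(SUP n. ?G n x) = (\<Sum>i=1..N. (SUP n. ennreal (p i x) * U n (w i x)))"
        using seq(3) by (intro ennreal_SUP_sum)
          (auto simp: incseq_def le_fun_def intro!: mult_left_mono)
      then show ?thesis by (simp add: SUP_mult_left_ennreal image_comp)
    qed
    have "(\<integral>\<^sup>+x. (SUP n. U n) x \<partial>dual_op (trans_op N w p) \<mu>)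
        = (SUP n. \<integral>\<^sup>+x. U n x \<partial>dual_op (trans_op N w p) \<mu>)"
      unfolding SUP_apply using seq(1)
      by (intro nn_integral_monotone_convergence_SUP seq(3)) (simp cong: measurable_cong_sets)
    also have "\<dots> = (SUP n. \<integral>\<^sup>+x. ?G n x \<partial>\<mu>)" using seq by simp
    also have "\<dots> = (\<integral>\<^sup>+x. (SUP n. ?G n x) \<partial>\<mu>)"
      by (rule nn_integral_monotone_convergence_SUP[symmetric, OF inc])
        (intro borel_measurable_sum gm seq)
    finally show ?case by (simp only: SU)
  qed
qed

lemma integral_dual_op:
  fixes \<phi> :: "'a::metric_space \<Rightarrow> real"
  assumes I: "ifs N w p" and mu: "\<mu> \<in> borel_prob"
    and f: "\<phi> \<in> borel_measurable borel" and B: "\<And>x. \<bar>\<phi> x\<bar> \<le> B"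
  shows "(\<integral>x. \<phi> x \<partial>dual_op (trans_op N w p) \<mu>) = (\<integral>x. trans_op N w p \<phi> x \<partial>\<mu>)"
proof -
  let ?P = "trans_op N w p"
  let ?\<nu> = "dual_op ?P \<mu>"
  interpret m: prob_space \<mu> using mu by (simp add: borel_prob_def)
  interpret n: prob_space ?\<nu> using dual_op_borel_prob[OF I mu] by (simp add: borel_prob_def)
  have s: "sets \<mu> = sets borel" using mu by (simp add: borel_prob_def)
  have B0: "0 \<le> \<phi> x + B" for x using B[of x] by linarith
  have B1: "\<bar>?P \<phi> x\<bar> \<le> B" for x by (rule trans_op_abs_le[OF I B])
  have B2: "0 \<le> ?P \<phi> x + B" for x using B1[of x] by linarith
  have i1: "integrable ?\<nu> \<phi>"
    by (rule n.integrable_const_bound[where B=B]) (use B f in \<open>auto cong: measurable_cong_sets\<close>)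
  have i2: "integrable \<mu> (?P \<phi>)"
    by (rule m.integrable_const_bound[where B=B])
      (use B1 trans_op_measurable[OF I f] in \<open>auto simp: measurable_cong_sets[OF s refl]\<close>)
  have pt: "(\<Sum>i=1..N. ennreal (p i x) * ennreal (\<phi> (w i x) + B)) = ennreal (?P \<phi> x + B)" for x
  proof -
    have "(\<Sum>i=1..N. ennreal (p i x) * ennreal (\<phi> (w i x) + B))
        = (\<Sum>i=1..N. ennreal (p i x * (\<phi> (w i x) + B)))"
      using I B0 by (intro sum.cong) (auto simp: ifs_def ennreal_mult)
    also have "\<dots> = ennreal (\<Sum>i=1..N. p i x * (\<phi> (w i x) + B))"
      using I B0 by (intro sum_ennreal) (auto simp: ifs_def)
    also have "(\<Sum>i=1..N. p i x * (\<phi> (w i x) + B)) = ?P \<phi> x + B * (\<Sum>i=1..N. p i x)"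
      by (simp add: trans_op_def algebra_simps sum.distrib sum_distrib_left)
    finally show ?thesis using I by (simp add: ifs_def)
  qed
  have "ennreal (\<integral>x. \<phi> x + B \<partial>?\<nu>) = (\<integral>\<^sup>+x. ennreal (\<phi> x + B) \<partial>?\<nu>)"
    using i1 B0 by (intro nn_integral_eq_integral[symmetric]) auto
  also have "\<dots> = (\<integral>\<^sup>+x. ennreal (?P \<phi> x + B) \<partial>\<mu>)"
    using f by (subst nn_integral_dual_op[OF I mu]) (simp_all only: pt, use f in measurable)
  also have "\<dots> = ennreal (\<integral>x. ?P \<phi> x + B \<partial>\<mu>)"
    using i2 B2 by (intro nn_integral_eq_integral) auto
  finally have "(\<integral>x. \<phi> x + B \<partial>?\<nu>) = (\<integral>x. ?P \<phi> x + B \<partial>\<mu>)"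
    using B0 B2 by (subst (asm) ennreal_inj) (auto intro!: integral_nonneg_AE)
  then show ?thesis using i1 i2 by (simp add: n.prob_space m.prob_space)
qed

lemma integral_dual_op_funpow:
  fixes \<phi> :: "'a::metric_space \<Rightarrow> real"
  assumes I: "ifs N w p" and "\<mu> \<in> borel_prob"
    and "\<phi> \<in> borel_measurable borel" and "\<And>x. \<bar>\<phi> x\<bar> \<le> B"
  shows "(\<integral>x. \<phi> x \<partial>(dual_op (trans_op N w p) ^^ n) \<mu>) = (\<integral>x. (trans_op N w p ^^ n) \<phi> x \<partial>\<mu>)"
  using assms(2-)
proof (induction n arbitrary: \<mu>)
  case (Suc n)
  have m: "(trans_op N w p ^^ n) \<phi> \<in> borel_measurable borel"
    by (induction n) (auto simp: Suc.prems intro!: trans_op_measurable[OF I])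
  have b: "\<bar>(trans_op N w p ^^ n) \<phi> x\<bar> \<le> B" for x
    by (induction n arbitrary: x) (auto simp: Suc.prems intro!: trans_op_abs_le[OF I])
  show ?case
    using Suc.IH[OF dual_op_borel_prob[OF I Suc.prems(1)] Suc.prems(2,3)]
      integral_dual_op[OF I Suc.prems(1) m b]
    by (simp add: funpow_swap1)
qed simp

lemma return_borel_prob: "return borel x \<in> borel_prob"
  by (simp add: borel_prob_def prob_space_return)

lemma integral_dual_op_funpow_return:
  fixes \<phi> :: "'a::metric_space \<Rightarrow> real"
  assumes I: "ifs N w p"
    and f: "\<phi> \<in> borel_measurable borel" and B: "\<And>x. \<bar>\<phi> x\<bar> \<le> B"
  shows "(\<integral>y. \<phi> y \<partial>(dual_op (trans_op N w p) ^^ n) (return borel x)) = (trans_op N w p ^^ n) \<phi> x"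
proof -
  have "(trans_op N w p ^^ n) \<phi> \<in> borel_measurable borel"
    by (induction n) (auto simp: f intro!: trans_op_measurable[OF I])
  then show ?thesis
    by (simp add: integral_dual_op_funpow[OF I return_borel_prob f B] integral_return)
qed

lemma measure_dual_op_funpow_return:
  fixes w :: "nat \<Rightarrow> 'a::metric_space \<Rightarrow> 'a"
  assumes I: "ifs N w p" and A: "A \<in> sets borel"
  shows "measure ((dual_op (trans_op N w p) ^^ n) (return borel x)) A
    = (trans_op N w p ^^ n) (indicator A) x"
proof -
  let ?M = "(dual_op (trans_op N w p) ^^ n) (return borel x)"
  have "sets ?M = sets borel" by (induction n) auto
  then have "measure ?M A = (\<integral>y. indicator A y \<partial>?M)"
    using sets_eq_imp_space_eq[of ?M borel] by simp
  also have "\<dots> = (trans_op N w p ^^ n) (indicator A) x"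
    by (rule integral_dual_op_funpow_return[OF I, where B=1]) (use A in \<open>auto simp: indicator_def\<close>)
  finally show ?thesis .
qed

end

theory Submission
  imports Defs
begin

text \<open>Write \<open>d = \<rho>(x, y)\<close>. By concavity of \<open>r\<close> and Jensen's inequality, every iterate \<open>P\<^sup>n f\<close> of a function
  with \<open>\<bar>f\<bar> \<le> 1\<close> and Lipschitz constant \<open>1\<close> has the modulus of continuity
  \<open>r\<^sup>n(d) + \<Sum>j<n. \<omega>(r\<^sup>j(d))\<close>, so the iterates are equicontinuous, uniformly in \<open>f\<close>. Since \<open>r(t) \<le> l t + s\<close>
  with \<open>l < 1\<close>, the function \<open>V = \<rho>(\<cdot>, x\<^sub>0)\<close> satisfies a drift condition \<open>P\<^sup>n V \<le> l\<^sup>n V + B\<close>. The contraction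
  \<open>w\<^sub>k\<close>, applied \<open>m\<close> times with probability at least \<open>(inf p\<^sub>k)\<^sup>m\<close>, brings two points of bounded \<open>V\<close> close
  together. As in the Hairer--Mattingly form of Harris' theorem, these facts make the oscillation of \<open>P\<^sup>n f\<close>,
  measured against the weight \<open>1 + V(x) + V(y)\<close>, tend to \<open>0\<close> uniformly in \<open>f\<close>. Hence \<open>P\<^sup>n f(x)\<close> converges
  to a positive functional \<open>\<Lambda> f\<close>, uniformly on bounded sets. Because \<open>P\<^sup>n f(x)\<close> depends on \<open>f\<close> only
  through finitely many values, uniformity in \<open>f\<close> makes \<open>\<Lambda>\<close> tight, hence \<open>\<sigma>\<close>-smooth, and the Daniell
  construction represents it by a measure. Bounded continuous functions are squeezed between Lipschitz
  functions.\<close>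

section \<open>Bounded Lipschitz functions\<close>

text \<open>The test functions of the whole argument: a lattice and algebra small enough for uniform
  estimates on the iterates, yet rich enough to determine a Borel probability measure.\<close>

definition blip :: "('a::metric_space \<Rightarrow> real) set" where
  "blip = {f. \<exists>B L. (\<forall>x. \<bar>f x\<bar> \<le> B) \<and> (\<forall>x y. \<bar>f x - f y\<bar> \<le> L * dist x y)}"

lemma blipI:
  assumes "\<And>x. \<bar>f x\<bar> \<le> B" "\<And>x y. \<bar>f x - f y\<bar> \<le> L * dist x y"
  shows "f \<in> blip"
  using assms by (auto simp: blip_def)

lemma blipE:
  assumes "f \<in> blip"
  obtains B L where "0 \<le> B" "0 \<le> L" "\<And>x. \<bar>f x\<bar> \<le> B" "\<And>x y. \<bar>f x - f y\<bar> \<le> L * dist x y"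
proof -
  obtain B L where *: "\<And>x. \<bar>f x\<bar> \<le> B" "\<And>x y. \<bar>f x - f y\<bar> \<le> L * dist x y"
    using assms by (auto simp: blip_def)
  show ?thesis
  proof
    show "0 \<le> B" using *(1)[of undefined] by linarith
    \<comment> \<open>On a one-point space \<open>L\<close> may be negative.\<close>
    show "0 \<le> max 0 L" by simp
    show "\<bar>f x\<bar> \<le> B" for x by (rule *)
    show "\<bar>f x - f y\<bar> \<le> max 0 L * dist x y" for x y
      using *(2)[of x y] mult_right_mono[of L "max 0 L" "dist x y"] by simp
  qed
qed

lemma blip_bounded: "f \<in> blip \<Longrightarrow> \<exists>B. \<forall>x. \<bar>f x\<bar> \<le> B"
  by (auto simp: blip_def)

lemma blip_continuous:
  assumes "f \<in> blip" shows "continuous_on UNIV f"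
proof -
  obtain B L where "0 \<le> B" "0 \<le> L" "\<And>x. \<bar>f x\<bar> \<le> B" "\<And>x y. \<bar>f x - f y\<bar> \<le> L * dist x y"
    using blipE[OF assms] by blast
  then have "L-lipschitz_on UNIV f" by (auto intro!: lipschitz_onI simp: dist_real_def)
  then show ?thesis by (rule lipschitz_on_continuous_on)
qed

lemma blip_measurable: "f \<in> blip \<Longrightarrow> f \<in> borel_measurable borel"
  by (intro borel_measurable_continuous_onI blip_continuous)

lemma blip_const [simp]: "(\<lambda>x. c) \<in> blip"
  by (rule blipI[where B="\<bar>c\<bar>" and L=0]) auto

lemma blip_add:
  assumes "f \<in> blip" "g \<in> blip" shows "(\<lambda>x. f x + g x) \<in> blip"
proof -
  obtain B L where f: "\<And>x. \<bar>f x\<bar> \<le> B" "\<And>x y. \<bar>f x - f y\<bar> \<le> L * dist x y"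
    using blipE[OF assms(1)] by metis
  obtain B' L' where g: "\<And>x. \<bar>g x\<bar> \<le> B'" "\<And>x y. \<bar>g x - g y\<bar> \<le> L' * dist x y"
    using blipE[OF assms(2)] by metis
  show ?thesis
  proof (rule blipI)
    show "\<bar>f x + g x\<bar> \<le> B + B'" for x using f(1)[of x] g(1)[of x] by linarith
    show "\<bar>(f x + g x) - (f y + g y)\<bar> \<le> (L + L') * dist x y" for x y
      using f(2)[of x y] g(2)[of x y] by (simp add: distrib_right)
  qed
qed

lemma blip_mult:
  assumes "f \<in> blip" "g \<in> blip" shows "(\<lambda>x. f x * g x) \<in> blip"
proof -
  obtain B L where f: "0 \<le> B" "\<And>x. \<bar>f x\<bar> \<le> B" "\<And>x y. \<bar>f x - f y\<bar> \<le> L * dist x y"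
    using blipE[OF assms(1)] by metis
  obtain B' L' where g: "0 \<le> B'" "\<And>x. \<bar>g x\<bar> \<le> B'" "\<And>x y. \<bar>g x - g y\<bar> \<le> L' * dist x y"
    using blipE[OF assms(2)] by metis
  show ?thesis
  proof (rule blipI)
    show "\<bar>f x * g x\<bar> \<le> B * B'" for x
      using f g by (auto simp: abs_mult intro!: mult_mono)
    fix x y
    have "f x * g x - f y * g y = f x * (g x - g y) + (f x - f y) * g y"
      by (simp add: algebra_simps)
    then have "\<bar>f x * g x - f y * g y\<bar> \<le> \<bar>f x\<bar> * \<bar>g x - g y\<bar> + \<bar>f x - f y\<bar> * \<bar>g y\<bar>"
      by (metis abs_mult abs_triangle_ineq)
    also have "\<dots> \<le> B * (L' * dist x y) + (L * dist x y) * B'"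
      using f g order_trans[OF abs_ge_zero f(3)] by (intro add_mono mult_mono) auto
    finally show "\<bar>f x * g x - f y * g y\<bar> \<le> (B * L' + L * B') * dist x y"
      by (simp add: algebra_simps)
  qed
qed

lemma blip_diff: "f \<in> blip \<Longrightarrow> g \<in> blip \<Longrightarrow> (\<lambda>x. f x - g x) \<in> blip"
  using blip_add[of f "\<lambda>x. (-1) * g x"] blip_mult[OF blip_const, of g "-1"] by simp

lemma blip_divide: "f \<in> blip \<Longrightarrow> (\<lambda>x. f x / c) \<in> blip"
  using blip_mult[OF blip_const, of f "1 / c"] by simp

lemma blip_sum: "(\<And>i. i \<in> I \<Longrightarrow> f i \<in> blip) \<Longrightarrow> (\<lambda>x. \<Sum>i\<in>I. f i x) \<in> blip"
  by (induction I rule: infinite_finite_induct) (auto intro: blip_add)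

lemma blip_abs:
  assumes "f \<in> blip" shows "(\<lambda>x. \<bar>f x\<bar>) \<in> blip"
proof -
  obtain B L where f: "\<And>x. \<bar>f x\<bar> \<le> B" "\<And>x y. \<bar>f x - f y\<bar> \<le> L * dist x y"
    using blipE[OF assms(1)] by metis
  show ?thesis
    by (rule blipI[where B=B and L=L]) (use f(1) order_trans[OF abs_triangle_ineq3 f(2)] in auto)
qed

lemma blip_max:
  assumes "f \<in> blip" "g \<in> blip" shows "(\<lambda>x. max (f x) (g x)) \<in> blip"
proof -
  have eq: "(\<lambda>x. max (f x) (g x)) = (\<lambda>x. ((f x + g x) + \<bar>f x - g x\<bar>) / 2)"
    by (auto simp: max_def)
  show ?thesis unfolding eq by (intro blip_divide blip_add blip_diff blip_abs assms)
qed

lemma blip_min: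
  assumes "f \<in> blip" "g \<in> blip" shows "(\<lambda>x. min (f x) (g x)) \<in> blip"
proof -
  have eq: "(\<lambda>x. min (f x) (g x)) = (\<lambda>x. ((f x + g x) - \<bar>f x - g x\<bar>) / 2)"
    by (auto simp: min_def)
  show ?thesis unfolding eq by (intro blip_divide blip_add blip_diff blip_abs assms)
qed

text \<open>With \<open>A\<close> closed and nonempty these cut-offs increase, as \<open>j\<close>
  grows, to the indicator of the complement; with \<open>A\<close> finite they measure how far mass
  lies from finitely many points.\<close>

lemma blip_infdist:
  assumes "0 \<le> j" shows "(\<lambda>x. min 1 (j * infdist x A)) \<in> blip"
proof (rule blipI[where B=1 and L=j])
  fix x y
  show "\<bar>min 1 (j * infdist x A)\<bar> \<le> 1" using assms infdist_nonneg[of x A] by auto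
  have "\<bar>j * infdist x A - j * infdist y A\<bar> \<le> j * dist x y"
    using assms infdist_triangle_abs[of x A y]
    by (simp add: abs_mult mult_left_mono flip: right_diff_distrib)
  then show "\<bar>min 1 (j * infdist x A) - min 1 (j * infdist y A)\<bar> \<le> j * dist x y" by linarith
qed

lemmas blip_intros = blip_const blip_add blip_diff blip_mult blip_divide blip_sum blip_abs
  blip_infdist blip_max blip_min

section \<open>Borel probability measures and Lipschitz test functions\<close>

lemma borel_prob_integrable:
  assumes "\<mu> \<in> borel_prob" "f \<in> borel_measurable borel" "\<And>x. \<bar>f x\<bar> \<le> (B::real)"
  shows "integrable \<mu> f"
proof -
  interpret prob_space \<mu> using assms(1) by (simp add: borel_prob_def)
  have s: "sets \<mu> = sets borel" using assms(1) by (simp add: borel_prob_def)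
  show ?thesis
    by (rule integrable_const_bound[where B=B])
      (use assms in \<open>auto simp: measurable_cong_sets[OF s refl]\<close>)
qed

lemma blip_integrable: "\<mu> \<in> borel_prob \<Longrightarrow> f \<in> blip \<Longrightarrow> integrable \<mu> f"
  using blip_bounded blip_measurable borel_prob_integrable by metis

lemma borel_prob_dominated_convergence:
  fixes f :: "nat \<Rightarrow> 'a::metric_space \<Rightarrow> real"
  assumes mu: "\<mu> \<in> borel_prob" and f: "\<And>n. f n \<in> borel_measurable borel"
    and g: "g \<in> borel_measurable borel"
    and B: "\<And>n x. \<bar>f n x\<bar> \<le> B" and lim: "\<And>x. (\<lambda>n. f n x) \<longlonglongrightarrow> g x"
  shows "(\<lambda>n. \<integral>x. f n x \<partial>\<mu>) \<longlonglongrightarrow> (\<integral>x. g x \<partial>\<mu>)"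
proof -
  interpret prob_space \<mu> using mu by (simp add: borel_prob_def)
  have s: "sets \<mu> = sets borel" using mu by (simp add: borel_prob_def)
  show ?thesis
    by (rule integral_dominated_convergence[where w="\<lambda>_. B"])
      (use f g B lim in \<open>auto simp: measurable_cong_sets[OF s refl]\<close>)
qed

lemma borel_prob_integral_const: "\<mu> \<in> borel_prob \<Longrightarrow> (\<integral>x. c \<partial>\<mu>) = (c::real)"
  by (simp add: borel_prob_def prob_space.prob_space)

text \<open>The indicator of a nonempty closed set is a pointwise limit of bounded Lipschitz
  functions, and the closed sets form an intersection-stable generator of the Borel sets.\<close>

lemma borel_prob_eqI:
  fixes \<mu> \<nu> :: "'a::metric_space measure"
  assumes mu: "\<mu> \<in> borel_prob" and nu: "\<nu> \<in> borel_prob"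
    and eq: "\<And>f. f \<in> blip \<Longrightarrow> (\<integral>x. f x \<partial>\<mu>) = (\<integral>x. f x \<partial>\<nu>)"
  shows "\<mu> = \<nu>"
proof -
  interpret m: prob_space \<mu> using mu by (simp add: borel_prob_def)
  interpret n: prob_space \<nu> using nu by (simp add: borel_prob_def)
  have s: "sets \<mu> = sets borel" "sets \<nu> = sets borel" using mu nu by (auto simp: borel_prob_def)
  have sp: "space \<mu> = UNIV" "space \<nu> = UNIV"
    using s sets_eq_imp_space_eq[of _ borel] by auto
  have closed_eq: "emeasure \<mu> C = emeasure \<nu> C" if C: "closed C" for C
  \<comment> \<open>\<open>infdist\<close> to the empty set is 0 by convention, so the cut-offs
    would not approximate its indicator.\<close>
  proof (cases "C = {}")
    case False
    let ?f = "\<lambda>n x. 1 - min 1 (real n * infdist x C)"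
    have f: "?f n \<in> blip" for n by (intro blip_intros) auto
    have b: "\<bar>?f n x\<bar> \<le> 1" for n x using infdist_nonneg[of x C] by (auto simp: min_def)
    have l: "(\<lambda>n. ?f n x) \<longlonglongrightarrow> indicator C x" for x
    proof (cases "x \<in> C")
      case True
      then show ?thesis by simp
    next
      case x: False
      then have pos: "infdist x C > 0" using infdist_pos_not_in_closed[OF C False] by simp
      obtain M :: nat where M: "real M > 1 / infdist x C" using reals_Archimedean2 by blast
      have "?f n x = 0" if "n \<ge> M" for n
      proof -
        have "1 / infdist x C \<le> real n" using M that by linarith
        then show ?thesis using pos by (simp add: field_simps)
      qed
      then have "\<forall>\<^sub>F n in sequentially. ?f n x = 0"
        by (auto simp: eventually_sequentially)
      then show ?thesis using x by (simp add: tendsto_eventually)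
    qed
    have i: "indicator C \<in> borel_measurable borel" using C by simp
    have "(\<lambda>n. \<integral>x. ?f n x \<partial>\<mu>) \<longlonglongrightarrow> (\<integral>x. indicator C x \<partial>\<mu>)"
      by (rule borel_prob_dominated_convergence[OF mu blip_measurable[OF f] i b l])
    moreover have "(\<lambda>n. \<integral>x. ?f n x \<partial>\<nu>) \<longlonglongrightarrow> (\<integral>x. indicator C x \<partial>\<nu>)"
      by (rule borel_prob_dominated_convergence[OF nu blip_measurable[OF f] i b l])
    ultimately have "(\<integral>x. indicator C x \<partial>\<mu>) = (\<integral>x. indicator C x \<partial>\<nu> :: real)"
      using eq[OF f] by (simp add: LIMSEQ_unique)
    then show ?thesis
      by (simp add: sp m.emeasure_eq_measure n.emeasure_eq_measure)
  qed simp
  show ?thesis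
  proof (rule measure_eqI_generator_eq[where E="{C. closed C}" and \<Omega>=UNIV and A="\<lambda>_. UNIV"])
    show "Int_stable {C :: 'a set. closed C}" by (auto simp: Int_stable_def)
    show "sets \<mu> = sigma_sets UNIV {C. closed C}" "sets \<nu> = sigma_sets UNIV {C. closed C}"
      using s by (simp_all add: borel_eq_closed)
  qed (use closed_eq in auto)
qed

text \<open>Taking the infimum of \<open>\<phi> y + n * dist x y\<close> over \<open>y\<close>
  forces an \<open>n\<close>-Lipschitz function below \<open>\<phi>\<close>; the growing penalty
  confines the relevant \<open>y\<close> to ever smaller balls around \<open>x\<close>, where
  continuity applies. The approximation is only pointwise, but it carries limits from Lipschitz to
  continuous functions.\<close>

lemma blip_approx_below:
  fixes \<phi> :: "'a::metric_space \<Rightarrow> real"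
  assumes c: "continuous_on UNIV \<phi>" and B: "\<And>x. \<bar>\<phi> x\<bar> \<le> B"
  shows "\<exists>F. (\<forall>n. F n \<in> blip) \<and> (\<forall>n x. F n x \<le> \<phi> x) \<and> (\<forall>n x. \<bar>F n x\<bar> \<le> B) \<and>
    (\<forall>x. (\<lambda>n. F n x) \<longlonglongrightarrow> \<phi> x)"
proof -
  \<comment> \<open>the Pasch--Hausdorff envelopes\<close>
  define F where "F n x = (INF y. \<phi> y + real n * dist x y)" for n :: nat and x
  have lb: "- B \<le> \<phi> y + real n * dist x y" for n x y
    using B[of y] by (smt (verit) mult_nonneg_nonneg of_nat_0_le_iff zero_le_dist)
  have bdd: "bdd_below (range (\<lambda>y. \<phi> y + real n * dist x y))" for n x
    using lb by (auto intro!: bdd_belowI[where m="-B"])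
  have le: "F n x \<le> \<phi> y + real n * dist x y" for n x y
    unfolding F_def by (rule cINF_lower[OF bdd]) auto
  have ge: "a \<le> F n x" if "\<And>y. a \<le> \<phi> y + real n * dist x y" for a n x
    unfolding F_def by (rule cINF_greatest) (use that in auto)
  have le\<phi>: "F n x \<le> \<phi> x" for n x using le[of n x x] by simp
  have bd: "\<bar>F n x\<bar> \<le> B" for n x
    using le\<phi>[of n x] B[of x] ge[OF lb, of n x] by linarith
  have lip: "F n x - F n y \<le> real n * dist x y" for n x y
  proof -
    have "F n x - real n * dist x y \<le> F n y"
    proof (rule ge)
      fix z
      have "real n * dist x z \<le> real n * (dist x y + dist y z)"
        by (intro mult_left_mono dist_triangle) auto
      then show "F n x - real n * dist x y \<le> \<phi> z + real n * dist y z"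
        using le[of n x z] by (simp add: algebra_simps)
    qed
    then show ?thesis by simp
  qed
  have "F n \<in> blip" for n
  proof (rule blipI[OF bd])
    show "\<bar>F n x - F n y\<bar> \<le> real n * dist x y" for x y
      using lip[of n x y] lip[of n y x] by (simp add: abs_le_iff dist_commute)
  qed
  moreover have "(\<lambda>n. F n x) \<longlonglongrightarrow> \<phi> x" for x
  proof (rule LIMSEQ_I)
    fix e :: real assume e: "e > 0"
    then obtain d where d: "d > 0" "\<And>y. dist y x < d \<Longrightarrow> \<bar>\<phi> y - \<phi> x\<bar> < e / 2"
      using c[unfolded continuous_on_iff, rule_format, of x "e/2"] by (auto simp: dist_real_def)
    \<comment> \<open>Beyond distance \<open>d\<close> the penalty outweighs \<open>2 * B\<close>,
      the largest possible oscillation of \<open>\<phi>\<close>.\<close>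
    obtain M :: nat where M: "real M > 2 * B / d" using reals_Archimedean2 by blast
    have "norm (F n x - \<phi> x) < e" if n: "n \<ge> M" for n
    proof -
      have "\<phi> x - e / 2 \<le> F n x"
      proof (rule ge)
        fix y
        show "\<phi> x - e / 2 \<le> \<phi> y + real n * dist x y"
        proof (cases "dist y x < d")
          case True
          have "0 \<le> real n * dist x y" by simp
          with d(2)[OF True] show ?thesis by linarith
        next
          case False
          have "2 * B \<le> real M * d" using M d(1) by (simp add: field_simps)
          also have "\<dots> \<le> real n * dist x y"
            using False n d(1) by (intro mult_mono) (auto simp: dist_commute)
          finally show ?thesis using B[of x] B[of y] e by linarith
        qed
      qed
      then show ?thesis using le\<phi>[of n x] e by simp
    qed
    then show "\<exists>M. \<forall>n\<ge>M. norm (F n x - \<phi> x) < e" by blast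
  qed
  ultimately show ?thesis using le\<phi> bd by blast
qed

section \<open>The Daniell representation\<close>

locale blip_mean =
  fixes \<Lambda> :: "('a::metric_space \<Rightarrow> real) \<Rightarrow> real"
  assumes add: "f \<in> blip \<Longrightarrow> g \<in> blip \<Longrightarrow> \<Lambda> (\<lambda>x. f x + g x) = \<Lambda> f + \<Lambda> g"
    and cmult: "f \<in> blip \<Longrightarrow> \<Lambda> (\<lambda>x. c * f x) = c * \<Lambda> f"
    and nonneg: "f \<in> blip \<Longrightarrow> (\<And>x. 0 \<le> f x) \<Longrightarrow> 0 \<le> \<Lambda> f"
    and one: "\<Lambda> (\<lambda>x. 1) = 1"
begin

lemma const: "\<Lambda> (\<lambda>x. c) = c"
  using cmult[of "\<lambda>_. 1" c] one by simp

lemma diff: "f \<in> blip \<Longrightarrow> g \<in> blip \<Longrightarrow> \<Lambda> (\<lambda>x. f x - g x) = \<Lambda> f - \<Lambda> g"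
  using add[of f "\<lambda>x. (-1) * g x"] cmult[of g "-1"] blip_mult[OF blip_const, of g "-1"] by simp

lemma mono: "f \<in> blip \<Longrightarrow> g \<in> blip \<Longrightarrow> (\<And>x. f x \<le> g x) \<Longrightarrow> \<Lambda> f \<le> \<Lambda> g"
  using nonneg[of "\<lambda>x. g x - f x"] diff[of g f] by (simp add: blip_diff)

lemma sum:
  assumes "\<And>i. i \<in> I \<Longrightarrow> f i \<in> blip"
  shows "\<Lambda> (\<lambda>x. \<Sum>i\<in>I. f i x) = (\<Sum>i\<in>I. \<Lambda> (f i))"
  using assms
proof (induction I rule: infinite_finite_induct)
  case (insert i I)
  have "\<Lambda> (\<lambda>x. f i x + (\<Sum>i\<in>I. f i x)) = \<Lambda> (f i) + \<Lambda> (\<lambda>x. \<Sum>i\<in>I. f i x)"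
    using insert.prems by (intro add blip_sum) auto
  with insert show ?case by simp
qed (simp_all add: const)

end

text \<open>Smoothness is Daniell's continuity condition. It excludes functionals such as Banach
  limits, which are positive, linear and normalised but come from no countably additive
  measure.\<close>

locale smooth_blip_mean = blip_mean +
  assumes smooth: "(\<And>n. f n \<in> blip) \<Longrightarrow> (\<And>n x. 0 \<le> f n x) \<Longrightarrow> (\<And>n x. f (Suc n) x \<le> f n x) \<Longrightarrow>
    (\<And>x. (\<lambda>n. f n x) \<longlonglongrightarrow> 0) \<Longrightarrow> (\<lambda>n. \<Lambda> (f n)) \<longlonglongrightarrow> 0"
begin

text \<open>The positive parts \<open>h n\<close> of \<open>g\<close> minus the partial sums
  decrease to 0, so smoothness makes the mean of the part still uncovered vanish. The sums are taken
  in \<open>ennreal\<close> because the cover may diverge.\<close>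

lemma le_suminf:
  assumes g: "g \<in> blip" "\<And>x. 0 \<le> g x" and f: "\<And>n. f n \<in> blip" "\<And>n x. 0 \<le> f n x"
    and cover: "\<And>x. ennreal (g x) \<le> (\<Sum>n. ennreal (f n x))"
  shows "ennreal (\<Lambda> g) \<le> (\<Sum>n. ennreal (\<Lambda> (f n)))"
proof -
  define h where "h n x = max 0 (g x - (\<Sum>k<n. f k x))" for n x
  have h: "h n \<in> blip" for n
    unfolding h_def using g f by (intro blip_max blip_diff blip_sum blip_const) auto
  have "(\<lambda>n. h n x) \<longlonglongrightarrow> 0" for x
  proof (rule LIMSEQ_I)
    fix e :: real assume e: "0 < e"
    have "\<exists>M. \<forall>n\<ge>M. g x - e < (\<Sum>k<n. f k x)"
    \<comment> \<open>\<open>ennreal\<close> truncates negative numbers to 0, so a negative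
      \<open>g x - e\<close> is treated directly.\<close>
    proof (cases "g x - e < 0")
      case True
      then show ?thesis using f(2) by (meson less_le_trans sum_nonneg)
    next
      case False
      have "ennreal (g x - e) < ennreal (g x)" using False e by (simp add: ennreal_less_iff)
      also note cover
      finally have "\<forall>\<^sub>F n in sequentially. ennreal (g x - e) < (\<Sum>k<n. ennreal (f k x))"
        by (rule order_tendstoD(1)[OF summable_LIMSEQ[OF summableI]])
      then show ?thesis
        using False f(2) by (auto simp: eventually_sequentially ennreal_less_iff)
    qed
    then show "\<exists>M. \<forall>n\<ge>M. norm (h n x - 0) < e" using e by (fastforce simp: h_def)
  qed
  then have lim: "(\<lambda>n. \<Lambda> (h n)) \<longlonglongrightarrow> 0"
  proof (intro smooth h)
    show "0 \<le> h n x" for n x by (simp add: h_def)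
    show "h (Suc n) x \<le> h n x" for n x
      unfolding h_def using f(2)[of n x] by (intro max.mono) auto
  qed
  have "ennreal (\<Lambda> g) \<le> ennreal (\<Lambda> (h n)) + (\<Sum>n. ennreal (\<Lambda> (f n)))" for n
  proof -
    have "\<Lambda> g \<le> \<Lambda> (\<lambda>x. h n x + (\<Sum>k<n. f k x))"
    proof (intro mono g)
      show "(\<lambda>x. h n x + (\<Sum>k<n. f k x)) \<in> blip" using h f by (intro blip_intros)
    qed (simp add: h_def)
    also have "\<dots> = \<Lambda> (h n) + (\<Sum>k<n. \<Lambda> (f k))"
      using f h by (subst add) (auto simp: sum intro: blip_sum)
    finally have "ennreal (\<Lambda> g) \<le> ennreal (\<Lambda> (h n) + (\<Sum>k<n. \<Lambda> (f k)))"
      by (rule ennreal_leI)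
    also have "\<dots> = ennreal (\<Lambda> (h n)) + (\<Sum>k<n. ennreal (\<Lambda> (f k)))"
      using nonneg[OF h] nonneg[OF f] by (simp add: h_def sum_nonneg)
    also have "\<dots> \<le> ennreal (\<Lambda> (h n)) + (\<Sum>n. ennreal (\<Lambda> (f n)))"
      by (intro add_left_mono sum_le_suminf) auto
    finally show ?thesis .
  qed
  moreover have "(\<lambda>n. ennreal (\<Lambda> (h n)) + (\<Sum>n. ennreal (\<Lambda> (f n))))
      \<longlonglongrightarrow> ennreal 0 + (\<Sum>n. ennreal (\<Lambda> (f n)))"
    by (intro tendsto_add tendsto_ennrealI lim tendsto_const)
  ultimately show ?thesis by (auto intro: LIMSEQ_le_const)
qed

section \<open>The outer measure generated by the functional\<close>

definition covers :: "'a set \<Rightarrow> (nat \<Rightarrow> 'a \<Rightarrow> real) set" where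
  "covers A = {f. (\<forall>n. f n \<in> blip) \<and> (\<forall>n x. 0 \<le> f n x) \<and> (\<forall>x\<in>A. 1 \<le> (\<Sum>n. ennreal (f n x)))}"

text \<open>The upper integral of the indicator of \<open>A\<close>: countable series of test
  functions play the role of countable open covers. Allowing series and not only single functions is
  what yields countable subadditivity.\<close>

definition upper :: "'a set \<Rightarrow> ennreal" where
  "upper A = (INF f\<in>covers A. \<Sum>n. ennreal (\<Lambda> (f n)))"

lemma upper_le: "f \<in> covers A \<Longrightarrow> upper A \<le> (\<Sum>n. ennreal (\<Lambda> (f n)))"
  unfolding upper_def by (rule INF_lower)

lemma upper_mono: "A \<subseteq> B \<Longrightarrow> upper A \<le> upper B"
  unfolding upper_def by (rule INF_superset_mono) (auto simp: covers_def)

lemma upper_le_blip: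
  assumes g: "g \<in> blip" "\<And>x. 0 \<le> g x" "\<And>x. x \<in> A \<Longrightarrow> 1 \<le> g x"
  shows "upper A \<le> ennreal (\<Lambda> g)"
proof -
  let ?f = "\<lambda>n::nat. if n = 0 then g else (\<lambda>x. 0)"
  have s: "(\<Sum>n. ennreal (?f n x)) = ennreal (g x)" for x
    by (subst suminf_finite[of "{0}"]) auto
  have "?f \<in> covers A"
    unfolding covers_def mem_Collect_eq s using g by (simp split: if_split)
  then have "upper A \<le> (\<Sum>n. ennreal (\<Lambda> (?f n)))" by (rule upper_le)
  also have "\<dots> = ennreal (\<Lambda> g)"
    by (subst suminf_finite[of "{0}"]) (auto simp: const)
  finally show ?thesis .
qed

text \<open>The lower counterpart of \<open>upper_le_blip\<close>, and the place where smoothness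
  enters: a cover of \<open>A\<close> dominates \<open>g\<close>, so \<open>le_suminf\<close>
  applies. It shows that no mass is lost, that is, \<open>upper UNIV = 1\<close>.\<close>

lemma blip_le_upper:
  assumes g: "g \<in> blip" "\<And>x. 0 \<le> g x" "\<And>x. g x \<le> indicator A x"
  shows "ennreal (\<Lambda> g) \<le> upper A"
  unfolding upper_def
proof (rule INF_greatest)
  fix f assume f: "f \<in> covers A"
  show "ennreal (\<Lambda> g) \<le> (\<Sum>n. ennreal (\<Lambda> (f n)))"
  proof (rule le_suminf[OF g(1,2)])
    fix x
    show "ennreal (g x) \<le> (\<Sum>n. ennreal (f n x))"
    proof (cases "x \<in> A")
      case True
      then have "ennreal (g x) \<le> 1" using g(3)[of x] by simp
      also have "\<dots> \<le> (\<Sum>n. ennreal (f n x))" using f True by (auto simp: covers_def)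
      finally show ?thesis .
    next
      case False
      then show ?thesis using g(3)[of x] by (simp add: ennreal_neg)
    qed
  qed (use f in \<open>auto simp: covers_def\<close>)
qed

lemma upper_empty: "upper {} = 0"
  using upper_le_blip[of "\<lambda>_. 0" "{}"] by (simp add: const)

lemma upper_UNIV: "upper UNIV = 1"
  using upper_le_blip[of "\<lambda>_. 1" UNIV] blip_le_upper[of "\<lambda>_. 1" UNIV]
  by (auto simp: one intro: antisym)

text \<open>Near-optimal covers, with surplus \<open>e * (1/2) ^ Suc i\<close> for
  \<open>A i\<close>, are interleaved by a pairing of the naturals into one cover of the union.
  Near-optimality presupposes finite values, so an infinite right-hand side is set aside
  first.\<close>

lemma upper_UN:
  fixes A :: "nat \<Rightarrow> 'a set"
  shows "upper (\<Union>i. A i) \<le> (\<Sum>i. upper (A i))"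
proof (cases "(\<Sum>i. upper (A i)) = \<infinity>")
  case False
  show ?thesis
  proof (rule ennreal_le_epsilon)
    fix e :: real assume e: "0 < e"
    have "\<exists>f\<in>covers (A i). (\<Sum>n. ennreal (\<Lambda> (f n))) < upper (A i) + ennreal (e * (1/2) ^ Suc i)" for i
    proof (rule INF_approx_ennreal)
      show "0 < e * (1/2) ^ Suc i" using e by simp
      have "upper (A i) \<le> (\<Sum>i. upper (A i))"
        using sum_le_suminf[OF summableI, of "{i}" "\<lambda>i. upper (A i)"] by simp
      then show "upper (A i) \<noteq> \<infinity>" using False by (auto simp: top_unique)
    qed (rule upper_def)
    then obtain f where f: "\<And>i. f i \<in> covers (A i)"
      "\<And>i. (\<Sum>n. ennreal (\<Lambda> (f i n))) < upper (A i) + ennreal (e * (1/2) ^ Suc i)"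
      by metis
    define F where "F m = f (fst (prod_decode m)) (snd (prod_decode m))" for m
    have dbl: "(\<Sum>m. G (fst (prod_decode m)) (snd (prod_decode m))) = (\<Sum>i. \<Sum>n. G i n)"
      for G :: "nat \<Rightarrow> nat \<Rightarrow> ennreal"
      using suminf_ennreal_2dimen[of "\<lambda>i. \<Sum>n. G i n" "\<lambda>(i,n). G i n"]
      by (simp add: comp_def split_beta)
    have "F \<in> covers (\<Union>i. A i)"
      unfolding covers_def
    proof (safe)
      show "F n \<in> blip" "0 \<le> F n x" for n x using f(1) by (auto simp: F_def covers_def)
      fix i x assume "x \<in> A i"
      then have "1 \<le> (\<Sum>n. ennreal (f i n x))" using f(1)[of i] by (auto simp: covers_def)
      also have "\<dots> \<le> (\<Sum>i. \<Sum>n. ennreal (f i n x))"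
        using sum_le_suminf[OF summableI, of "{i}" "\<lambda>i. \<Sum>n. ennreal (f i n x)"] by simp
      also have "\<dots> = (\<Sum>m. ennreal (F m x))"
        unfolding F_def by (rule dbl[of "\<lambda>i n. ennreal (f i n x)", symmetric])
      finally show "1 \<le> (\<Sum>m. ennreal (F m x))" .
    qed
    then have "upper (\<Union>i. A i) \<le> (\<Sum>m. ennreal (\<Lambda> (F m)))" by (rule upper_le)
    also have "\<dots> = (\<Sum>i. \<Sum>n. ennreal (\<Lambda> (f i n)))"
      unfolding F_def by (rule dbl[of "\<lambda>i n. ennreal (\<Lambda> (f i n))"])
    also have "\<dots> \<le> (\<Sum>i. upper (A i) + ennreal (e * (1/2) ^ Suc i))"
      using f(2) by (intro suminf_le summableI) (auto simp: less_imp_le)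
    also have "\<dots> = (\<Sum>i. upper (A i)) + (\<Sum>i. ennreal (e * (1/2) ^ Suc i))"
      by (rule suminf_add[symmetric]) auto
    also have "(\<Sum>i. ennreal (e * (1/2) ^ Suc i)) = ennreal e"
      using sums_mult[OF power_half_series, of e] e
      by (intro suminf_ennreal_eq) (auto simp: mult.commute)
    finally show "upper (\<Union>i. A i) \<le> (\<Sum>i. upper (A i)) + ennreal e" .
  qed
qed simp

lemma outer_measure_space_upper: "outer_measure_space UNIV upper"
  by (auto simp: outer_measure_space_def positive_def increasing_def countably_subadditive_def
      upper_empty upper_mono upper_UN)

lemma upper_Un: "upper (A \<union> B) \<le> upper A + upper B"
proof -
  let ?A = "\<lambda>i::nat. if i = 0 then A else if i = 1 then B else {}"
  have "(\<Union>i. ?A i) = A \<union> B" by (auto split: if_splits)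
  moreover have "(\<Sum>i. upper (?A i)) = upper A + upper B"
    by (subst suminf_finite[of "{0, 1}"]) (auto simp: upper_empty)
  ultimately show ?thesis using upper_UN[of ?A] by simp
qed

text \<open>Caratheodory's condition for \<open>C\<close>. The function \<open>u j\<close> vanishes
  on \<open>C\<close> and tends to 1 off it, so for a cover \<open>f\<close> of \<open>A\<close> the
  functions \<open>f n * (1 - u j)\<close> still cover \<open>A \<inter> C\<close>, while the
  functions \<open>f n * u j\<close> cover \<open>A - C\<close> up to a defect. The two parts have
  together exactly the mean of \<open>f\<close>, and the price of the defect is
  \<open>l - \<Lambda> (u j)\<close>, which tends to 0.\<close>

lemma upper_caratheodory_closed:
  assumes C: "closed C"
  shows "upper (A \<inter> C) + upper (A - C) \<le> upper A"
proof (cases "C = {}")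
  case False
  define u where "u j x = min 1 (real j * infdist x C)" for j x
  have u: "u j \<in> blip" for j unfolding u_def[abs_def] by (intro blip_intros) auto
  have u01: "0 \<le> u j x" "u j x \<le> 1" for j x by (auto simp: u_def infdist_nonneg)
  have umono: "u j x \<le> u (Suc j) x" for j x
    using mult_right_mono[of "real j" "real (Suc j)" "infdist x C"] infdist_nonneg[of x C]
    unfolding u_def by (intro min.mono) auto
  have ulim: "(\<lambda>j. u j x) \<longlonglongrightarrow> 1" if "x \<notin> C" for x
  proof -
    have pos: "infdist x C > 0" using infdist_pos_not_in_closed[OF C False that] .
    obtain M :: nat where M: "real M > 1 / infdist x C" using reals_Archimedean2 by blast
    have "u n x = 1" if "n \<ge> M" for n
    proof -
      have "1 / infdist x C \<le> real n" using M that by linarith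
      then show ?thesis using pos by (simp add: field_simps u_def)
    qed
    then have "\<forall>\<^sub>F n in sequentially. u n x = 1" by (auto simp: eventually_sequentially)
    then show ?thesis by (rule tendsto_eventually)
  qed
  \<comment> \<open>\<open>u\<close> increases to the indicator of the complement of
    \<open>C\<close>, so \<open>l\<close> may be smaller than 1; what matters is that the increments
    beyond \<open>j\<close> have total mean \<open>l - \<Lambda> (u j)\<close>.\<close>
  obtain l where l: "(\<lambda>j. \<Lambda> (u j)) \<longlonglongrightarrow> l" "\<And>j. \<Lambda> (u j) \<le> l"
    using incseq_convergent[of "\<lambda>j. \<Lambda> (u j)" 1] mono[OF u u umono] mono[OF u blip_const[of 1]] u01 one
    by (auto simp: incseq_Suc_iff)
  have tele: "(\<Sum>i. ennreal (a (Suc (i + j)) - a (i + j))) = ennreal (b - a j)"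
    if "\<And>i. a i \<le> a (Suc i)" "a \<longlonglongrightarrow> b" for a :: "nat \<Rightarrow> real" and b j
  proof -
    have "(\<lambda>i. a (i + j)) \<longlonglongrightarrow> b" using that(2) by (rule LIMSEQ_ignore_initial_segment)
    from telescope_sums[OF this] show ?thesis
      using that(1) by (intro suminf_ennreal_eq) auto
  qed
  have key: "upper (A \<inter> C) + upper (A - C) \<le> (\<Sum>n. ennreal (\<Lambda> (f n))) + ennreal (l - \<Lambda> (u j))"
    if f: "f \<in> covers A" for f j
  proof -
    have fb: "f n \<in> blip" and f0: "0 \<le> f n x" for n x using f by (auto simp: covers_def)
    have b1: "(\<lambda>x. f n x * (1 - u j x)) \<in> blip" and b2: "(\<lambda>x. f n x * u j x) \<in> blip" for n
      using fb u by (intro blip_intros; blast)+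
    \<comment> \<open>On \<open>A - C\<close>, the part \<open>1 - u j\<close> that \<open>f n * u j\<close> misses is the telescoping series of the
      increments of \<open>u\<close> beyond \<open>j\<close>, whose total mean vanishes as \<open>j\<close> grows.\<close>
    define g where "g n x = f n x * u j x + (u (Suc (n + j)) x - u (n + j) x)" for n x
    have "(\<lambda>n x. f n x * (1 - u j x)) \<in> covers (A \<inter> C)"
      unfolding covers_def
    proof (intro CollectI conjI allI ballI)
      fix x assume x: "x \<in> A \<inter> C"
      then have "u j x = 0" by (simp add: u_def)
      then show "1 \<le> (\<Sum>n. ennreal (f n x * (1 - u j x)))"
        using f x by (simp add: covers_def)
    qed (use b1 f0 u01 in simp_all)
    then have "upper (A \<inter> C) \<le> (\<Sum>n. ennreal (\<Lambda> (\<lambda>x. f n x * (1 - u j x))))"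
      by (rule upper_le)
    moreover have "g \<in> covers (A - C)"
      unfolding covers_def
    proof (intro CollectI conjI allI ballI)
      show "g n \<in> blip" for n unfolding g_def by (intro blip_add blip_mult blip_diff fb u)
      show "0 \<le> g n x" for n x
        unfolding g_def using f0[of n x] u01(1)[of j x] umono[of "n + j" x] by auto
      fix x assume "x \<in> A - C"
      then have x: "x \<in> A" "x \<notin> C" by auto
      have "1 = ennreal (u j x) + ennreal (1 - u j x)"
        using u01[of j x] by (subst ennreal_plus[symmetric]) auto
      also have "\<dots> \<le> (\<Sum>n. ennreal (f n x)) * ennreal (u j x) + ennreal (1 - u j x)"
      proof (rule add_right_mono)
        have "1 \<le> (\<Sum>n. ennreal (f n x))" using f x by (auto simp: covers_def)
        from mult_right_mono[OF this, of "ennreal (u j x)"]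
        show "ennreal (u j x) \<le> (\<Sum>n. ennreal (f n x)) * ennreal (u j x)"
          by (simp only: mult_1 zero_le)
      qed
      also have "(\<Sum>n. ennreal (f n x)) * ennreal (u j x) = (\<Sum>n. ennreal (f n x * u j x))"
        by (simp only: ennreal_suminf_multc[symmetric] ennreal_mult[OF f0 u01(1)])
      also have "ennreal (1 - u j x) = (\<Sum>i. ennreal (u (Suc (i + j)) x - u (i + j) x))"
        using tele[of "\<lambda>i. u i x" 1 j, OF umono ulim[OF x(2)]] by (rule sym)
      also have "(\<Sum>n. ennreal (f n x * u j x)) + \<dots> = (\<Sum>n. ennreal (g n x))"
      proof (subst suminf_add[OF summableI summableI], intro suminf_cong)
        fix n
        show "ennreal (f n x * u j x) + ennreal (u (Suc (n + j)) x - u (n + j) x) = ennreal (g n x)"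
          unfolding g_def using f0[of n x] u01(1)[of j x] umono[of "n + j" x]
          by (intro ennreal_plus[symmetric]) auto
      qed
      finally show "1 \<le> (\<Sum>n. ennreal (g n x))" .
    qed
    then have "upper (A - C) \<le> (\<Sum>n. ennreal (\<Lambda> (g n)))" by (rule upper_le)
    moreover have "(\<Sum>n. ennreal (\<Lambda> (g n)))
        = (\<Sum>n. ennreal (\<Lambda> (\<lambda>x. f n x * u j x))) + (\<Sum>i. ennreal (\<Lambda> (u (Suc (i + j))) - \<Lambda> (u (i + j))))"
    proof (subst suminf_add[OF summableI summableI], intro suminf_cong)
      fix n
      have "\<Lambda> (g n) = \<Lambda> (\<lambda>x. f n x * u j x) + (\<Lambda> (u (Suc (n + j))) - \<Lambda> (u (n + j)))"
        unfolding g_def by (subst add[OF b2 blip_diff[OF u u]]) (simp add: diff u)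
      then show "ennreal (\<Lambda> (g n))
          = ennreal (\<Lambda> (\<lambda>x. f n x * u j x)) + ennreal (\<Lambda> (u (Suc (n + j))) - \<Lambda> (u (n + j)))"
        using nonneg[OF b2] f0 u01 mono[OF u u umono] by (simp add: ennreal_plus)
    qed
    moreover have "(\<Sum>i. ennreal (\<Lambda> (u (Suc (i + j))) - \<Lambda> (u (i + j)))) = ennreal (l - \<Lambda> (u j))"
      by (rule tele[of "\<lambda>i. \<Lambda> (u i)" l j, OF mono[OF u u umono] l(1)])
    moreover have "(\<Sum>n. ennreal (\<Lambda> (\<lambda>x. f n x * (1 - u j x)))) + (\<Sum>n. ennreal (\<Lambda> (\<lambda>x. f n x * u j x)))
        = (\<Sum>n. ennreal (\<Lambda> (f n)))"
    proof (subst suminf_add[OF summableI summableI], intro suminf_cong)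
      fix n
      have "\<Lambda> (f n) = \<Lambda> (\<lambda>x. f n x * (1 - u j x)) + \<Lambda> (\<lambda>x. f n x * u j x)"
        by (subst add[OF b1 b2, symmetric]) (simp add: algebra_simps)
      then show "ennreal (\<Lambda> (\<lambda>x. f n x * (1 - u j x))) + ennreal (\<Lambda> (\<lambda>x. f n x * u j x)) = ennreal (\<Lambda> (f n))"
        using nonneg[OF b1] nonneg[OF b2] f0 u01 by (simp flip: ennreal_plus)
    qed
    ultimately show ?thesis
      using add_mono[of "upper (A \<inter> C)" "\<Sum>n. ennreal (\<Lambda> (\<lambda>x. f n x * (1 - u j x)))"
          "upper (A - C)" "(\<Sum>n. ennreal (\<Lambda> (\<lambda>x. f n x * u j x))) + ennreal (l - \<Lambda> (u j))"]
      by (simp add: add.assoc[symmetric])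
  qed
  have "upper (A \<inter> C) + upper (A - C) \<le> (\<Sum>n. ennreal (\<Lambda> (f n)))" if f: "f \<in> covers A" for f
  proof (rule LIMSEQ_le_const)
    have "(\<lambda>j. (\<Sum>n. ennreal (\<Lambda> (f n))) + ennreal (l - \<Lambda> (u j)))
        \<longlonglongrightarrow> (\<Sum>n. ennreal (\<Lambda> (f n))) + ennreal (l - l)"
      by (intro tendsto_intros tendsto_ennrealI l)
    then show "(\<lambda>j. (\<Sum>n. ennreal (\<Lambda> (f n))) + ennreal (l - \<Lambda> (u j))) \<longlonglongrightarrow> (\<Sum>n. ennreal (\<Lambda> (f n)))"
      by simp
  qed (use key[OF f] in auto)
  then show ?thesis unfolding upper_def[of A] by (rule INF_greatest)
qed (simp add: upper_empty)

section \<open>The representing measure\<close>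

definition rep :: "'a measure" where
  "rep = measure_of UNIV (sets borel) upper"

lemma sets_rep [simp]: "sets rep = sets borel"
  unfolding rep_def by (metis sets.sigma_sets_eq sets_measure_of space_borel top_greatest Pow_UNIV)

lemma space_rep [simp]: "space rep = UNIV"
  using sets_eq_imp_space_eq[OF sets_rep] by simp

text \<open>Caratheodory's lemma makes \<open>upper\<close> countably additive on its
  \<open>lambda_system\<close>. That system is a sigma-algebra containing the closed sets, hence all
  Borel sets, so \<open>measure_of\<close> does not fall back on the null measure.\<close>

lemma emeasure_rep: "A \<in> sets borel \<Longrightarrow> emeasure rep A = upper A"
proof (rule emeasure_measure_of[OF rep_def])
  interpret P: sigma_algebra UNIV "UNIV :: 'a set set" using sigma_algebra_Pow[of UNIV] by simp
  let ?L = "lambda_system UNIV UNIV upper"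
  have ms: "measure_space UNIV ?L upper"
    by (rule P.caratheodory_lemma[OF outer_measure_space_upper])
  have "C \<in> ?L" if "closed C" for C
    unfolding P.lambda_system_eq
  proof (intro CollectI conjI ballI antisym)
    show "upper x \<le> upper (x \<inter> C) + upper (x - C)" for x
      using upper_Un[of "x \<inter> C" "x - C"] by (simp add: Int_Diff_Un)
  qed (use upper_caratheodory_closed[OF that] in auto)
  then have "sigma_sets UNIV {C. closed C} \<subseteq> ?L"
    using ms by (intro sigma_algebra.sigma_sets_subset) (auto simp: measure_space_def)
  then have "sets borel \<subseteq> ?L" by (simp add: borel_eq_closed)
  then show "countably_additive (sets rep) upper"
    using ms by (auto simp: measure_space_def countably_additive_def)
  show "positive (sets rep) upper" by (simp add: positive_def upper_empty)
qed auto

lemma rep_borel_prob: "rep \<in> borel_prob"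
  by (auto simp: borel_prob_def emeasure_rep upper_UNIV intro!: prob_spaceI)

text \<open>A layer-cake comparison in \<open>m\<close> slices. The ramp \<open>\<phi> i\<close>
  climbs from 0 to 1 while \<open>f\<close> passes from \<open>i / m\<close> to
  \<open>(i + 1) / m\<close>, so it is 1 on the level set \<open>E i\<close> and its mean bounds the
  measure of \<open>E i\<close>. The ramps add up to \<open>m * f\<close>, and \<open>m * f\<close>
  exceeds the sum of the indicators of the level sets by at most 1; division by \<open>m\<close>
  leaves the error \<open>1 / m\<close>.\<close>

lemma integral_rep_le:
  assumes f: "f \<in> blip" "\<And>x. 0 \<le> f x" "\<And>x. f x \<le> 1"
  shows "(\<integral>x. f x \<partial>rep) \<le> \<Lambda> f"
proof -
  interpret prob_space rep using rep_borel_prob by (simp add: borel_prob_def)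
  have fm: "f \<in> borel_measurable borel" using f(1) by (rule blip_measurable)
  have "(\<integral>x. f x \<partial>rep) \<le> \<Lambda> f + 1 / real m" if m: "m > 0" for m :: nat
  proof -
    define \<phi> where "\<phi> i x = max 0 (min 1 (real m * f x - real i))" for i x
    define E where "E i = {x. real (Suc i) \<le> real m * f x}" for i
    have E: "E i \<in> sets borel" for i unfolding E_def using fm by measurable
    have \<phi>: "\<phi> i \<in> blip" for i unfolding \<phi>_def[abs_def] by (intro blip_intros f)
    have ind: "real m * f x \<le> 1 + (\<Sum>i<m. indicator (E i) x)" and
      sum\<phi>: "(\<Sum>i<m. \<phi> i x) = real m * f x" for x
    proof -
      have a: "t \<le> real m \<longrightarrow> t \<le> 1 + (\<Sum>i<m. if real (Suc i) \<le> t then 1 else 0)"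
        if "0 \<le> t" for t :: real and m :: nat
      proof (induction m)
        case (Suc m)
        show ?case
        proof (cases "t \<le> real m")
          case True
          then show ?thesis using Suc by auto
        next
          case False
          have "(\<Sum>i<m. if real (Suc i) \<le> t then 1 else 0) = (\<Sum>i<m. 1::real)"
            using False by (intro sum.cong) auto
          then show ?thesis by auto
        qed
      qed (use that in auto)
      have b: "(\<Sum>i<m. max 0 (min 1 (t - real i))) = min t (real m)" if "0 \<le> t" for t :: real and m :: nat
        using that by (induction m) auto
      have t: "0 \<le> real m * f x" "real m * f x \<le> real m"
        using f(2,3)[of x] mult_left_mono[of "f x" 1 "real m"] by auto
      show "real m * f x \<le> 1 + (\<Sum>i<m. indicator (E i) x)"
        using a[OF t(1), of m] t(2) by (simp only: E_def indicator_def mem_Collect_eq of_bool_def)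
      show "(\<Sum>i<m. \<phi> i x) = real m * f x"
        using b[OF t(1), of m] t(2) by (simp add: \<phi>_def)
    qed
    have E\<phi>: "measure rep (E i) \<le> \<Lambda> (\<phi> i)" for i
    proof -
      have "ennreal (measure rep (E i)) = upper (E i)"
        using E by (simp add: emeasure_rep flip: emeasure_eq_measure)
      also have "\<dots> \<le> ennreal (\<Lambda> (\<phi> i))"
        by (rule upper_le_blip[OF \<phi>]) (auto simp: \<phi>_def E_def)
      finally show ?thesis using nonneg[OF \<phi>, of i] by (simp add: \<phi>_def)
    qed
    have "real m * (\<integral>x. f x \<partial>rep) = (\<integral>x. real m * f x \<partial>rep)" by simp
    also have "\<dots> \<le> (\<integral>x. 1 + (\<Sum>i<m. indicator (E i) x) \<partial>rep)"
      by (intro integral_mono ind) (use E blip_integrable[OF rep_borel_prob f(1)] in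
        \<open>auto intro!: Bochner_Integration.integrable_sum simp: emeasure_eq_measure\<close>)
    also have "\<dots> = 1 + (\<Sum>i<m. measure rep (E i))"
      using E by (subst Bochner_Integration.integral_add)
        (auto simp: emeasure_eq_measure prob_space[simplified] Bochner_Integration.integral_sum)
    also have "\<dots> \<le> 1 + (\<Sum>i<m. \<Lambda> (\<phi> i))" by (intro add_left_mono sum_mono E\<phi>)
    also have "(\<Sum>i<m. \<Lambda> (\<phi> i)) = real m * \<Lambda> f"
      using sum[of "{..<m}" \<phi>] \<phi> f(1) by (simp add: sum\<phi> cmult)
    finally show ?thesis using m by (simp add: field_simps)
  qed
  then have "(\<integral>x. f x \<partial>rep) \<le> \<Lambda> f + 1 / real (Suc m)" for m by blast
  moreover have "(\<lambda>m. \<Lambda> f + 1 / real (Suc m)) \<longlonglongrightarrow> \<Lambda> f + 0"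
    by (intro tendsto_add tendsto_const lim_1_over_n[THEN LIMSEQ_Suc])
  ultimately show ?thesis by (auto intro: LIMSEQ_le_const)
qed

text \<open>One inequality is available for functions with values between 0 and 1. An affine map
  takes \<open>f\<close> to such a \<open>g\<close>, and the inequality for \<open>g\<close> and for
  \<open>1 - g\<close> gives both directions.\<close>

theorem integral_rep:
  assumes f: "f \<in> blip"
  shows "(\<integral>x. f x \<partial>rep) = \<Lambda> f"
proof -
  obtain B where B: "\<And>x. \<bar>f x\<bar> \<le> B" using blip_bounded[OF f] by blast
  define M where "M = B + 1"
  have M: "M > 0" using B[of undefined] by (simp add: M_def)
  have bd: "- M \<le> f x" "f x \<le> M" for x using B[of x] by (auto simp: M_def)
  define g where "g x = 1/2 + (1 / (2 * M)) * f x" for x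
  have gb: "g \<in> blip" unfolding g_def[abs_def] by (intro blip_intros f)
  have g01: "0 \<le> g x" "g x \<le> 1" for x using bd[of x] M by (auto simp: g_def field_simps)
  have \<Lambda>g: "\<Lambda> g = 1/2 + (1 / (2 * M)) * \<Lambda> f"
    unfolding g_def[abs_def] using f by (subst add) (auto simp only: const cmult intro: blip_const blip_mult)
  interpret prob_space rep using rep_borel_prob by (simp add: borel_prob_def)
  have ig: "(\<integral>x. g x \<partial>rep) = 1/2 + (1 / (2 * M)) * (\<integral>x. f x \<partial>rep)"
    using blip_integrable[OF rep_borel_prob f] prob_space by (simp add: g_def)
  have "(\<integral>x. g x \<partial>rep) \<le> \<Lambda> g" by (rule integral_rep_le[OF gb g01])
  moreover have "(\<integral>x. 1 - g x \<partial>rep) \<le> \<Lambda> (\<lambda>x. 1 - g x)"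
    by (rule integral_rep_le) (use gb g01 in \<open>auto intro: blip_diff\<close>)
  moreover have "(\<integral>x. 1 - g x \<partial>rep) = 1 - (\<integral>x. g x \<partial>rep)"
    using blip_integrable[OF rep_borel_prob gb] prob_space by simp
  ultimately have "(\<integral>x. g x \<partial>rep) = \<Lambda> g" using gb by (simp add: diff one)
  then show ?thesis using M by (simp add: \<Lambda>g ig)
qed

end

text \<open>Dini's theorem with tightness in place of compactness. On the points close to every
  \<open>F k\<close> with \<open>k < n\<close>, the function \<open>f n\<close> is small by a
  compactness argument that uses completeness; elsewhere it is at most \<open>B\<close> and is
  dominated by penalties of small total mean.\<close>

lemma smooth_blip_mean_if_tight:
  fixes \<Lambda> :: "('b::complete_space \<Rightarrow> real) \<Rightarrow> real"
  assumes "blip_mean \<Lambda>"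
    and tight: "\<And>e. 0 < e \<Longrightarrow> \<exists>F. finite F \<and> F \<noteq> {} \<and> \<Lambda> (\<lambda>x. min 1 (infdist x F)) \<le> e"
  shows "smooth_blip_mean \<Lambda>"
proof -
  interpret m: blip_mean \<Lambda> by fact
  show ?thesis
  proof
    fix f :: "nat \<Rightarrow> 'b \<Rightarrow> real"
    assume f: "\<And>n. f n \<in> blip" "\<And>n x. 0 \<le> f n x" "\<And>n x. f (Suc n) x \<le> f n x"
      and lim: "\<And>x. (\<lambda>n. f n x) \<longlonglongrightarrow> 0"
    have dec: "f n x \<le> f k x" if "k \<le> n" for k n x
      using lift_Suc_antimono_le[of "\<lambda>n. f n x", OF f(3) that] .
    obtain C where C: "\<And>x. \<bar>f 0 x\<bar> \<le> C" using blip_bounded[OF f(1)] by blast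
    define B where "B = \<bar>C\<bar> + 1"
    have B: "0 < B" "f 0 x \<le> B" for x using C[of x] by (auto simp: B_def)
    have bound: "\<exists>n. \<Lambda> (f n) \<le> e + e" if e: "0 < e" for e
    proof -
      \<comment> \<open>One power of \<open>1/2\<close> pays for the weight \<open>2 ^ Suc k\<close>
        in \<open>?g\<close> below, and the other makes the bounds sum to at most
        \<open>e\<close>.\<close>
      have "\<forall>k. \<exists>F. finite F \<and> F \<noteq> {} \<and> \<Lambda> (\<lambda>x. min 1 (infdist x F)) \<le> (e / B) * (1/4) ^ Suc k"
        using e B by (intro allI tight) simp
      then obtain F where F: "\<And>k. finite (F k)" "\<And>k. F k \<noteq> {}"
        "\<And>k. \<Lambda> (\<lambda>x. min 1 (infdist x (F k))) \<le> (e / B) * (1/4) ^ Suc k"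
        by (auto dest!: choice)
      \<comment> \<open>Otherwise some sequence \<open>y\<close> stays near the sets
        \<open>F k\<close> with \<open>f n (y n)\<close> at least \<open>e\<close>; it has a limit
        point, at which no \<open>f k\<close> falls below \<open>e\<close>, contradicting pointwise
        convergence to 0.\<close>
      have "\<exists>n. \<forall>x. (\<forall>k<n. infdist x (F k) \<le> (1/2) ^ Suc k) \<longrightarrow> f n x < e"
      proof (rule ccontr)
        assume "\<not> ?thesis"
        then have "\<forall>n. \<exists>x. (\<forall>k<n. infdist x (F k) \<le> (1/2) ^ Suc k) \<and> e \<le> f n x"
          by (simp add: not_less)
        then obtain y where y: "\<And>n k. k < n \<Longrightarrow> infdist (y n) (F k) \<le> (1/2) ^ Suc k" "\<And>n. e \<le> f n (y n)"
          by (auto dest!: choice)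
        let ?K = "closure (range y)"
        have "compact ?K"
          unfolding compact_eq_totally_bounded
        proof (intro conjI allI impI)
          show "uniform_space_class.complete ?K" by (simp add: complete_eq_closed)
          fix d :: real assume d: "0 < d"
          obtain k where k: "(1/2) ^ k < d / 2"
            using real_arch_pow_inv[of "d/2" "1/2"] d by auto
          \<comment> \<open>Every later \<open>y n\<close> lies near \<open>F k\<close>; only the
            first \<open>k + 1\<close> points have to be added as centres.\<close>
          let ?G = "F k \<union> y ` {..k}"
          have "range y \<subseteq> (\<Union>x\<in>?G. cball x (d / 2))"
          proof safe
            fix n
            show "y n \<in> (\<Union>x\<in>?G. cball x (d / 2))"
            proof (cases "n \<le> k")
              case True
              then have "y n \<in> ?G" "y n \<in> cball (y n) (d / 2)" using d by auto
              then show ?thesis by (rule UN_I)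
            next
              case False
              then have "infdist (y n) (F k) \<le> (1/2) ^ Suc k" using y(1)[of k n] by simp
              also have "\<dots> < d / 2" using k zero_less_power[of "1/2::real" k] by (simp only: power_Suc) linarith
              finally have "(INF a\<in>F k. dist (y n) a) < d / 2" using F(2) by (simp add: infdist_notempty)
              then obtain a where "a \<in> F k" "dist (y n) a < d / 2"
                using F(2) by (subst (asm) cINF_less_iff) auto
              then have "a \<in> ?G" "y n \<in> cball a (d / 2)" by (auto simp: dist_commute)
              then show ?thesis by (rule UN_I)
            qed
          qed
          then have "?K \<subseteq> (\<Union>x\<in>?G. cball x (d / 2))"
            by (rule closure_minimal) (intro closed_UN ballI closed_cball finite_UnI F finite_imageI finite_atMost)
          also have "\<dots> \<subseteq> (\<Union>x\<in>?G. ball x d)"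
            using d by (intro UN_mono order_refl subsetI) (simp add: mem_ball mem_cball)
          finally show "\<exists>k. finite k \<and> ?K \<subseteq> (\<Union>x\<in>k. ball x d)"
            by (intro exI[of _ ?G] conjI finite_UnI F finite_imageI finite_atMost)
        qed
        then have "\<exists>l\<in>?K. \<exists>s::nat\<Rightarrow>nat. strict_mono s \<and> (y \<circ> s) \<longlonglongrightarrow> l"
          unfolding compact_def
          using closure_subset[of "range y"] by (elim allE[where x=y] mp) auto
        then obtain l s where s: "strict_mono (s :: nat \<Rightarrow> nat)" "(y \<circ> s) \<longlonglongrightarrow> l" by blast
        have "e \<le> f k l" for k
        proof (rule LIMSEQ_le_const)
          have "isCont (f k) l"
            using blip_continuous[OF f(1)] by (simp add: continuous_on_eq_continuous_at)
          then show "(\<lambda>n. f k (y (s n))) \<longlonglongrightarrow> f k l"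
            using isCont_tendsto_compose[OF _ s(2)] by (simp add: comp_def)
          have "e \<le> f k (y (s n))" if "k \<le> n" for n
            using y(2)[of "s n"] dec[of k "s n" "y (s n)"] seq_suble[OF s(1), of n] that by linarith
          then show "\<exists>N. \<forall>n\<ge>N. e \<le> f k (y (s n))" by blast
        qed
        then have "e \<le> 0" using LIMSEQ_le_const[OF lim[of l], of e] by blast
        then show False using e by simp
      qed
      then obtain n where n: "\<And>x. (\<And>k. k < n \<Longrightarrow> infdist x (F k) \<le> (1/2) ^ Suc k) \<Longrightarrow> f n x < e"
        by blast
      \<comment> \<open>Where \<open>infdist x (F k)\<close> exceeds \<open>(1/2) ^ Suc k\<close>,
        this penalty is at least \<open>B\<close>, a bound for every \<open>f n\<close>.\<close>
      let ?g = "\<lambda>k x. (B * 2 ^ Suc k) * min 1 (1 * infdist x (F k))"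
      have g: "?g k \<in> blip" for k by (intro blip_intros) simp
      have g0: "0 \<le> ?g k x" for k x using B infdist_nonneg[of x "F k"] by simp
      have "\<Lambda> (f n) \<le> \<Lambda> (\<lambda>x. e + (\<Sum>k<n. ?g k x))"
      proof (rule m.mono[OF f(1)])
        show "(\<lambda>x. e + (\<Sum>k<n. ?g k x)) \<in> blip" by (intro blip_add blip_const blip_sum g)
        fix x
        show "f n x \<le> e + (\<Sum>k<n. ?g k x)"
        proof (cases "\<forall>k<n. infdist x (F k) \<le> (1/2) ^ Suc k")
          case True
          then have "f n x < e" using n by blast
          moreover have "0 \<le> (\<Sum>k<n. ?g k x)" by (intro sum_nonneg g0)
          ultimately show ?thesis by linarith
        next
          case False
          then obtain k where k: "k < n" "(1/2) ^ Suc k < infdist x (F k)" by auto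
          have "(1/2::real) ^ Suc k \<le> 1" by (rule power_le_one) auto
          then have "(1/2) ^ Suc k \<le> min 1 (infdist x (F k))" using k by simp
          from mult_left_mono[OF this, of "B * 2 ^ Suc k"] B(1)
          have "B \<le> ?g k x" by (simp add: power_one_over field_simps)
          also have "\<dots> \<le> (\<Sum>k<n. ?g k x)"
            using k g0 by (intro member_le_sum) auto
          finally show ?thesis using dec[of 0 n x] B(2)[of x] e by linarith
        qed
      qed
      also have "\<dots> = e + (\<Sum>k<n. \<Lambda> (?g k))"
        using g by (subst m.add) (auto simp: m.const m.sum intro: blip_sum)
      also have "\<dots> \<le> e + (\<Sum>k<n. e * (1/2) ^ Suc k)"
      proof (intro add_left_mono sum_mono)
        fix k
        have "\<Lambda> (?g k) = (B * 2 ^ Suc k) * \<Lambda> (\<lambda>x. min 1 (1 * infdist x (F k)))"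
          by (rule m.cmult[OF blip_infdist]) simp
        also have "\<dots> \<le> (B * 2 ^ Suc k) * ((e / B) * (1/4) ^ Suc k)"
          using F(3)[of k] B(1) by (intro mult_left_mono) auto
        also have "\<dots> = e * (2 ^ Suc k * (1/4) ^ Suc k)" using B(1) by (simp add: field_simps)
        also have "2 ^ Suc k * (1/4) ^ Suc k = (1/2::real) ^ Suc k"
          by (subst power_mult_distrib[symmetric]) simp
        finally show "\<Lambda> (?g k) \<le> e * (1/2) ^ Suc k" .
      qed
      also have "\<dots> \<le> e + e"
      proof -
        have "(\<Sum>k<n. (1/2::real) ^ Suc k) \<le> (\<Sum>k. (1/2) ^ Suc k)"
          by (rule sum_le_suminf) (use power_half_series in \<open>auto simp: sums_iff\<close>)
        also have "\<dots> = 1" using power_half_series by (simp add: sums_iff)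
        finally have "e * (\<Sum>k<n. (1/2::real) ^ Suc k) \<le> e * 1" using e by (intro mult_left_mono) auto
        then show ?thesis by (simp only: sum_distrib_left mult_1_right add_left_mono)
      qed
      finally show ?thesis by blast
    qed
    show "(\<lambda>n. \<Lambda> (f n)) \<longlonglongrightarrow> 0"
    proof (rule LIMSEQ_I)
      fix e :: real assume "0 < e"
      then obtain n where n: "\<Lambda> (f n) \<le> e/4 + e/4" using bound[of "e/4"] by auto
      have "norm (\<Lambda> (f k) - 0) < e" if "n \<le> k" for k
        using m.mono[OF f(1) f(1) dec[OF that]] n m.nonneg[OF f(1,2), of k] \<open>0 < e\<close> by simp
      then show "\<exists>n. \<forall>k\<ge>n. norm (\<Lambda> (f k) - 0) < e" by blast
    qed
  qed
qed

section \<open>Iterates of the transition operator\<close>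

locale iterated_function_system =
  fixes N :: nat and w :: "nat \<Rightarrow> 'a::metric_space \<Rightarrow> 'a" and p :: "nat \<Rightarrow> 'a \<Rightarrow> real"
  assumes ifs: "ifs N w p"
begin

abbreviation P where "P \<equiv> trans_op N w p"

lemma p_nonneg: "i \<in> {1..N} \<Longrightarrow> 0 \<le> p i x" and p_le_1: "i \<in> {1..N} \<Longrightarrow> p i x \<le> 1"
  using ifs by (auto simp: ifs_def)

lemma p_sum: "(\<Sum>i=1..N. p i x) = 1"
  using ifs by (simp add: ifs_def)

lemma P_add: "P (\<lambda>x. f x + g x) = (\<lambda>x. P f x + P g x)"
  by (simp add: trans_op_def fun_eq_iff distrib_right sum.distrib)

lemma P_cmult: "P (\<lambda>x. c * f x) = (\<lambda>x. c * P f x)"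
  by (simp add: trans_op_def fun_eq_iff sum_distrib_left mult.assoc)

lemma P_const: "P (\<lambda>x. c) = (\<lambda>x. c)"
  by (simp only: trans_op_def[abs_def] sum_distrib_left[symmetric] p_sum mult_1_right)

lemma P_mono: "(\<And>x. f x \<le> g x) \<Longrightarrow> P f x \<le> P g x"
  unfolding trans_op_def by (intro sum_mono mult_right_mono p_nonneg)

lemma iter_add: "(P ^^ n) (\<lambda>x. f x + g x) = (\<lambda>x. (P ^^ n) f x + (P ^^ n) g x)"
  by (induction n) (simp_all add: P_add)

lemma iter_cmult: "(P ^^ n) (\<lambda>x. c * f x) = (\<lambda>x. c * (P ^^ n) f x)"
  by (induction n) (simp_all add: P_cmult)

lemma iter_const: "(P ^^ n) (\<lambda>x. c) = (\<lambda>x. c)"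
  by (induction n) (simp_all add: P_const)

lemma iter_diff: "(P ^^ n) (\<lambda>x. f x - g x) = (\<lambda>x. (P ^^ n) f x - (P ^^ n) g x)"
  using iter_add[of n f "\<lambda>x. (-1) * g x"] by (simp add: iter_cmult[of n "-1", simplified])

lemma iter_mono: "(\<And>x. f x \<le> g x) \<Longrightarrow> (P ^^ n) f x \<le> (P ^^ n) g x"
  by (induction n arbitrary: x) (auto intro: P_mono)

lemma iter_nonneg: "(\<And>x. 0 \<le> f x) \<Longrightarrow> 0 \<le> (P ^^ n) f x"
  using iter_mono[of "\<lambda>_. 0" f n x] by (simp add: iter_const)

lemma iter_abs_le: "(\<And>x. \<bar>f x\<bar> \<le> B) \<Longrightarrow> \<bar>(P ^^ n) f x\<bar> \<le> B"
  by (induction n arbitrary: x) (auto intro: trans_op_abs_le[OF ifs])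

lemma iter_continuous: "continuous_on UNIV f \<Longrightarrow> continuous_on UNIV ((P ^^ n) f)"
proof (induction n)
  case (Suc n)
  have "continuous_on UNIV (\<lambda>x. \<Sum>i=1..N. (P ^^ n) f (w i x) * p i x)"
  proof (intro continuous_on_sum continuous_on_mult)
    fix i assume "i \<in> {1..N}"
    then have "continuous_on UNIV (w i)" and p: "continuous_on UNIV (p i)"
      using ifs by (auto simp: ifs_def)
    then show "continuous_on UNIV (\<lambda>x. (P ^^ n) f (w i x))"
      using Suc by (auto intro: continuous_on_compose2[of UNIV "(P ^^ n) f" UNIV "w i"])
    show "continuous_on UNIV (\<lambda>x. p i x)" using p .
  qed
  then show ?case by (simp add: trans_op_def[abs_def])
qed simp

text \<open>An iterate at \<open>x\<close> is a weighted sum over the images of \<open>x\<close>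
  under compositions of \<open>n\<close> maps. The finite set does not depend on \<open>f\<close>;
  \<open>limit_mean_tight\<close> rests on this.\<close>

lemma iter_eq_0_on_finite:
  "\<exists>F. finite F \<and> F \<noteq> {} \<and> (\<forall>f. (\<forall>y\<in>F. f y = 0) \<longrightarrow> (P ^^ n) f x = 0)"
proof (induction n arbitrary: x)
  case 0
  show ?case by (intro exI[of _ "{x}"]) simp
next
  case (Suc n)
  then have "\<exists>F. \<forall>x. finite (F x) \<and> F x \<noteq> {} \<and> (\<forall>f. (\<forall>y\<in>F x. f y = 0) \<longrightarrow> (P ^^ n) f x = 0)"
    by (intro choice allI)
  then obtain F where F: "\<And>x. finite (F x)" "\<And>x. F x \<noteq> {}"
    "\<And>x f. \<forall>y\<in>F x. f y = 0 \<Longrightarrow> (P ^^ n) f x = 0"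
    by blast
  show ?case
  proof (intro exI[of _ "F x \<union> (\<Union>i\<in>{1..N}. F (w i x))"] conjI allI impI)
    fix f :: "'a \<Rightarrow> real" assume "\<forall>y\<in>F x \<union> (\<Union>i\<in>{1..N}. F (w i x)). f y = 0"
    then have "(P ^^ n) f (w i x) = 0" if "i \<in> {1..N}" for i using that by (intro F) auto
    then show "(P ^^ Suc n) f x = 0" by (simp add: trans_op_def)
  qed (use F in auto)
qed

end

section \<open>Moduli of continuity\<close>

text \<open>Jensen's inequality; it carries contraction on average through a concave
  modulus.\<close>

lemma concave_on_sum_le:
  fixes a y :: "'i \<Rightarrow> real"
  assumes "finite S" "concave_on C h" "(\<Sum>i\<in>S. a i) = 1"
    and "\<And>i. i \<in> S \<Longrightarrow> 0 \<le> a i" "\<And>i. i \<in> S \<Longrightarrow> y i \<in> C"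
  shows "(\<Sum>i\<in>S. a i * h (y i)) \<le> h (\<Sum>i\<in>S. a i * y i)"
proof -
  have "S \<noteq> {}" using assms(3) by auto
  from convex_on_sum[OF assms(1) this assms(2)[unfolded concave_on_def] assms(3-5)]
  show ?thesis by (simp add: sum_negf)
qed

lemma concave_on_compose:
  fixes h g :: "real \<Rightarrow> real"
  assumes h: "concave_on {0..} h" "mono_on {0..} h" and g: "concave_on {0..} g" "\<And>t. 0 \<le> t \<Longrightarrow> 0 \<le> g t"
  shows "concave_on {0..} (\<lambda>t. h (g t))"
  unfolding concave_on_iff
proof (intro conjI ballI allI impI)
  fix x y u v :: real
  assume *: "x \<in> {0..}" "y \<in> {0..}" "0 \<le> u" "0 \<le> v" "u + v = 1"
  have "u * h (g x) + v * h (g y) \<le> h (u * g x + v * g y)"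
    using h(1) g(2) * by (auto simp: concave_on_iff)
  also have "\<dots> \<le> h (g (u *\<^sub>R x + v *\<^sub>R y))"
    using g * by (intro mono_onD[OF h(2)]) (auto simp: concave_on_iff)
  finally show "u * h (g x) + v * h (g y) \<le> h (g (u *\<^sub>R x + v *\<^sub>R y))" .
qed simp

text \<open>The solution of the recursion that sends a modulus \<open>h\<close> to
  \<open>h (r t) + \<omega> t\<close>, started from the modulus \<open>t\<close> of a 1-Lipschitz
  function. This recursion is the effect of one application of \<open>P\<close>, see
  \<open>P_modulus\<close>.\<close>

definition iter_modulus :: "(real \<Rightarrow> real) \<Rightarrow> (real \<Rightarrow> real) \<Rightarrow> nat \<Rightarrow> real \<Rightarrow> real" where
  "iter_modulus r \<omega> n t = (r ^^ n) t + (\<Sum>j<n. \<omega> ((r ^^ j) t))"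

lemma iter_modulus_0: "iter_modulus r \<omega> 0 = (\<lambda>t. t)"
  by (simp add: iter_modulus_def fun_eq_iff)

lemma iter_modulus_Suc: "iter_modulus r \<omega> (Suc n) = (\<lambda>t. iter_modulus r \<omega> n (r t) + \<omega> t)"
  by (simp add: iter_modulus_def fun_eq_iff sum.lessThan_Suc_shift funpow_swap1 del: sum.lessThan_Suc)

lemma mono_on_iterate:
  fixes r :: "real \<Rightarrow> real"
  assumes "\<And>t. 0 \<le> t \<Longrightarrow> 0 \<le> r t" "mono_on {0..} r" "0 \<le> s" "s \<le> t"
  shows "0 \<le> (r ^^ n) s \<and> (r ^^ n) s \<le> (r ^^ n) t"
proof (induction n)
  case (Suc n)
  then show ?case
    using assms(1)[of "(r ^^ n) s"] mono_onD[OF assms(2), of "(r ^^ n) s" "(r ^^ n) t"] by simp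
qed (use assms in simp)

locale modulus_couple =
  fixes r \<omega> :: "real \<Rightarrow> real"
  assumes couple: "(r, \<omega>) \<in> couples"
    and r_concave: "concave_on {0..} r" and \<omega>_concave: "concave_on {0..} \<omega>"
begin

lemma r_nonneg: "0 \<le> t \<Longrightarrow> 0 \<le> r t" and \<omega>_nonneg: "0 \<le> t \<Longrightarrow> 0 \<le> \<omega> t"
  and r_mono: "mono_on {0..} r" and \<omega>_mono: "mono_on {0..} \<omega>"
  and r_0: "r 0 = 0" and \<omega>_0: "\<omega> 0 = 0"
  and \<omega>_cont: "continuous (at 0 within {0..}) \<omega>"
  using couple by (auto simp: couples_def)

lemma iter_modulus_concave_mono:
  "concave_on {0..} (iter_modulus r \<omega> n) \<and> mono_on {0..} (iter_modulus r \<omega> n)"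
proof (induction n)
  case 0
  show ?case by (auto simp: iter_modulus_0 concave_on_ident intro: mono_onI)
next
  case (Suc n)
  have "mono_on {0..} (\<lambda>t. iter_modulus r \<omega> n (r t) + \<omega> t)"
  proof (intro mono_onI add_mono)
    fix s t :: real assume st: "s \<in> {0..}" "t \<in> {0..}" "s \<le> t"
    then show "\<omega> s \<le> \<omega> t" by (rule mono_onD[OF \<omega>_mono])
    have "r s \<le> r t" using st by (rule mono_onD[OF r_mono])
    with Suc show "iter_modulus r \<omega> n (r s) \<le> iter_modulus r \<omega> n (r t)"
      using st r_nonneg by (intro mono_onD[of "{0..}" "iter_modulus r \<omega> n"]) auto
  qed
  moreover have "concave_on {0..} (\<lambda>t. iter_modulus r \<omega> n (r t) + \<omega> t)"
    using Suc by (intro concave_on_add[OF concave_on_compose[OF _ _ r_concave r_nonneg] \<omega>_concave]) auto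
  ultimately show ?case by (simp add: iter_modulus_Suc)
qed

lemma threshold:
  "\<exists>T>0. \<forall>t. 0 < t \<and> t < T \<longrightarrow> r t < t \<and> summable (\<lambda>n. \<omega> ((r ^^ Suc n) t))"
  using couple unfolding couples_def by simp

text \<open>A concave nonnegative \<open>r\<close> with \<open>r 0 = 0\<close> has nonincreasing
  \<open>r t / t\<close>. So a single \<open>s\<close> with \<open>r s < s\<close> bounds the slope
  from there on, and monotonicity controls the interval up to \<open>s\<close>.\<close>

lemma affine_bound:
  obtains l s where "0 \<le> l" "l < 1" "0 \<le> s" "\<And>t. 0 \<le> t \<Longrightarrow> r t \<le> l * t + s"
proof -
  obtain T where T: "0 < T" "\<And>t. 0 < t \<Longrightarrow> t < T \<Longrightarrow> r t < t" using threshold by blast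
  define s where "s = T / 2"
  have s: "0 < s" "r s < s" using T(1) T(2)[of s] by (auto simp: s_def)
  have "r t \<le> r s / s * t + s" if t: "0 \<le> t" for t
  proof (cases "t \<le> s")
    case True
    then have "r t \<le> r s" using t by (intro mono_onD[OF r_mono]) auto
    moreover have "0 \<le> r s / s * t" using t s r_nonneg[of s] by simp
    ultimately show ?thesis using s by linarith
  next
    case False
    then have ts: "s < t" by simp
    have "(1 - s / t) * r 0 + (s / t) * r t \<le> r ((1 - s / t) *\<^sub>R 0 + (s / t) *\<^sub>R t)"
      using ts s by (intro concave_onD[OF r_concave]) auto
    then have "(s / t) * r t \<le> r s" using ts s by (simp add: r_0)
    then have "r t \<le> r s / s * t" using ts s by (simp add: field_simps)
    then show ?thesis using s by linarith
  qed
  moreover have "0 \<le> r s / s" "r s / s < 1" using s r_nonneg[of s] by auto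
  ultimately show ?thesis using that[of "r s / s" s] s by auto
qed

lemma \<omega>_small:
  assumes "0 < e" obtains d where "0 < d" "\<And>t. 0 \<le> t \<Longrightarrow> t \<le> d \<Longrightarrow> \<omega> t \<le> e"
proof -
  have "\<exists>d>0. \<forall>t\<in>{0..}. dist t 0 < d \<longrightarrow> dist (\<omega> t) (\<omega> 0) < e"
    using \<omega>_cont assms unfolding continuous_within_eps_delta by blast
  then obtain d where d: "d > 0" "\<And>t. 0 \<le> t \<Longrightarrow> \<bar>t\<bar> < d \<Longrightarrow> \<bar>\<omega> t - \<omega> 0\<bar> < e"
    by (auto simp: dist_real_def)
  show ?thesis
  proof
    show "0 < d / 2" using d by simp
    show "\<omega> t \<le> e" if "0 \<le> t" "t \<le> d / 2" for t
      using d(1) d(2)[of t] that by (simp add: \<omega>_0)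
  qed
qed

text \<open>Started from a late point \<open>d\<close> of an orbit of \<open>r\<close>, the sum is
  part of a tail of the convergent series in \<open>couples\<close>. This needs positive points
  arbitrarily far along the orbit, so an orbit that reaches 0 is treated separately.\<close>

lemma sum_\<omega>_small:
  assumes e: "0 < e"
  obtains d where "0 < d" "r d \<le> d" "\<And>n. (\<Sum>j<n. \<omega> ((r ^^ j) d)) \<le> e"
proof -
  obtain T where T0: "0 < T"
    and T': "\<forall>t. 0 < t \<and> t < T \<longrightarrow> r t < t \<and> summable (\<lambda>n. \<omega> ((r ^^ Suc n) t))"
    using threshold by (elim exE conjE)
  have T: "0 < T" "\<And>t. 0 < t \<Longrightarrow> t < T \<Longrightarrow> r t < t"
    "\<And>t. 0 < t \<Longrightarrow> t < T \<Longrightarrow> summable (\<lambda>n. \<omega> ((r ^^ Suc n) t))"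
    using T0 T'[rule_format] by blast+
  define t where "t = T / 2"
  have t: "0 < t" "t < T" using T(1) by (auto simp: t_def)
  have itn: "0 \<le> (r ^^ n) t" for n
    using mono_on_iterate[of r t t n] r_nonneg r_mono t by simp
  have \<omega>n: "0 \<le> \<omega> ((r ^^ n) t)" for n using \<omega>_nonneg[OF itn] .
  \<comment> \<open>The series in \<open>couples\<close> starts with the first iterate; the term for
    \<open>n = 0\<close> does not affect convergence.\<close>
  have sm: "summable (\<lambda>n. \<omega> ((r ^^ n) t))"
    using T(3)[OF t] by (subst summable_Suc_iff[symmetric])
  show ?thesis
  proof (cases "\<forall>n. 0 < (r ^^ n) t")
    case True
    have ltT: "(r ^^ n) t < T" for n
    proof (induction n)
      case (Suc n)
      then show ?case using T(2)[of "(r ^^ n) t"] True by simp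
    qed (use t in simp)
    obtain M where M: "norm (\<Sum>j. \<omega> ((r ^^ (j + M)) t)) < e"
      using suminf_exist_split[OF e sm] by blast
    have M': "(\<Sum>j. \<omega> ((r ^^ (j + M)) t)) < e"
      using M unfolding real_norm_def by (rule le_less_trans[OF abs_ge_self])
    show ?thesis
    proof (rule that[of "(r ^^ M) t"])
      show "0 < (r ^^ M) t" using True by simp
      show "r ((r ^^ M) t) \<le> (r ^^ M) t" using T(2)[of "(r ^^ M) t"] True ltT by (simp add: less_imp_le)
      have "(\<Sum>j<n. \<omega> ((r ^^ (j + M)) t)) \<le> (\<Sum>j. \<omega> ((r ^^ (j + M)) t))" for n
        by (rule sum_le_suminf[OF summable_ignore_initial_segment[OF sm]]) (simp_all add: \<omega>n)
      then have "(\<Sum>j<n. \<omega> ((r ^^ (j + M)) t)) \<le> e" for n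
        using M' by (rule order.trans[OF _ less_imp_le])
      then show "(\<Sum>j<n. \<omega> ((r ^^ j) ((r ^^ M) t))) \<le> e" for n
        by (simp only: funpow_add comp_def)
    qed
  next
    \<comment> \<open>\<open>r\<close> vanishes near \<open>0\<close>, so only the term \<open>j = 0\<close> contributes.\<close>
    case False
    then obtain n' where "\<not> 0 < (r ^^ n') t" by blast
    then have z: "(r ^^ n') t = 0" using itn[of n'] by linarith
    \<comment> \<open>The last positive point \<open>s\<close> of the orbit satisfies
      \<open>r s = 0\<close>, and monotonicity extends this to all smaller arguments.\<close>
    define n where "n = (LEAST n. (r ^^ n) t = 0)"
    have n: "(r ^^ n) t = 0" unfolding n_def by (rule LeastI[of _ n'], rule z)
    then have "n \<noteq> 0" using t(1) by (intro notI) simp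
    then obtain m where m: "n = Suc m" by (cases n) auto
    define s where "s = (r ^^ m) t"
    have "(r ^^ m) t \<noteq> 0" using not_less_Least[of m "\<lambda>n. (r ^^ n) t = 0"] m by (simp only: n_def[symmetric]) simp
    then have s: "0 < s" "r s = 0" using itn[of m] n by (simp_all add: s_def m)
    obtain d where d: "0 < d" "\<And>t. 0 \<le> t \<Longrightarrow> t \<le> d \<Longrightarrow> \<omega> t \<le> e" using \<omega>_small[OF e] by blast
    define q where "q = min s d"
    have q: "0 < q" using s d by (simp add: q_def)
    have rq: "r q = 0"
      using mono_onD[OF r_mono, of q s] r_nonneg[of q] q s by (auto simp: q_def)
    have rn: "(r ^^ Suc n) q = 0" for n by (induction n) (simp_all add: rq r_0)
    show ?thesis
    proof (rule that[OF q])
      show "r q \<le> q" using rq q by simp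
      show "(\<Sum>j<n. \<omega> ((r ^^ j) q)) \<le> e" for n
      proof (cases n)
        case (Suc m)
        have "(\<Sum>j<Suc m. \<omega> ((r ^^ j) q)) = \<omega> q"
          by (simp only: sum.lessThan_Suc_shift rn) (simp add: \<omega>_0)
        also have "\<dots> \<le> e" using q by (intro d) (auto simp: q_def)
        finally show ?thesis using Suc by simp
      qed (use e in simp)
    qed
  qed
qed

lemma iter_modulus_small:
  assumes e: "0 < e"
  obtains d where "0 < d" "\<And>n t. 0 \<le> t \<Longrightarrow> t \<le> d \<Longrightarrow> iter_modulus r \<omega> n t \<le> e"
proof -
  obtain d where d: "0 < d" "r d \<le> d" "\<And>n. (\<Sum>j<n. \<omega> ((r ^^ j) d)) \<le> e / 2"
    using sum_\<omega>_small[of "e / 2"] e by auto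
  obtain T where T: "0 < T" "\<And>t. 0 < t \<Longrightarrow> t < T \<Longrightarrow> r t < t" using threshold by blast
  show ?thesis
  proof
    \<comment> \<open>\<open>d\<close> bounds the sum, \<open>T / 2\<close> keeps the orbit of
      \<open>t\<close> from growing, and \<open>e / 2\<close> bounds the iterate
      \<open>(r ^^ n) t\<close>.\<close>
    show "0 < min d (min (T / 2) (e / 2))" using d T e by simp
    fix n t assume t: "0 \<le> t" "t \<le> min d (min (T / 2) (e / 2))"
    have "(r ^^ n) t \<le> t"
    proof (induction n)
      case (Suc n)
      have n0: "0 \<le> (r ^^ n) t" using mono_on_iterate[of r t t n] r_nonneg r_mono t by simp
      have "r ((r ^^ n) t) \<le> (r ^^ n) t"
      proof (cases "(r ^^ n) t = 0")
        case False
        then show ?thesis using T Suc t n0 by (intro less_imp_le T(2)) auto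
      qed (simp add: r_0)
      then show ?case using Suc by simp
    qed simp
    moreover have "(\<Sum>j<n. \<omega> ((r ^^ j) t)) \<le> (\<Sum>j<n. \<omega> ((r ^^ j) d))"
    proof (intro sum_mono mono_onD[OF \<omega>_mono])
      fix j
      show "(r ^^ j) t \<in> {0..}" "(r ^^ j) d \<in> {0..}" "(r ^^ j) t \<le> (r ^^ j) d"
        using mono_on_iterate[of r t d j] r_nonneg r_mono t by auto
    qed
    ultimately show "iter_modulus r \<omega> n t \<le> e"
      using d(3)[of n] t by (simp add: iter_modulus_def)
  qed
qed

end

section \<open>Merging of the iterates\<close>

text \<open>The intervals from \<open>g u - s u\<close> to \<open>g u + s u\<close> meet pairwise,
  hence have a common point; the supremum of the left ends is one.\<close>

lemma oscillation_center:
  fixes g s :: "'b \<Rightarrow> real"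
  assumes "\<And>u v. g u - g v \<le> s u + s v"
  obtains c where "\<And>u. \<bar>g u - c\<bar> \<le> s u"
proof -
  define c where "c = (SUP u. g u - s u)"
  have le: "g u - s u \<le> g v + s v" for u v using assms[of u v] by linarith
  then have "bdd_above (range (\<lambda>u. g u - s u))" by (auto intro!: bdd_aboveI)
  then have "g u - s u \<le> c" for u unfolding c_def by (rule cSUP_upper[rotated]) auto
  moreover have "c \<le> g u + s u" for u unfolding c_def by (rule cSUP_least) (use le in auto)
  ultimately show ?thesis using that[of c] by (auto simp: abs_le_iff algebra_simps)
qed

text \<open>The numerical core of the Harris argument, with \<open>W = V x + V y\<close>. The choice
  of \<open>\<beta>\<close> makes the additive drift term \<open>2 * \<beta> * B\<close> equal to
  \<open>\<kappa> / 2\<close>. For small \<open>W\<close> the coupling gain \<open>\<kappa>\<close>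
  outweighs it; for large \<open>W\<close> the drift saves
  \<open>t = (1 - l) * (\<beta> * W)\<close>, which is at least \<open>\<kappa>\<close>. Either way
  a factor \<open>1 - \<theta>\<close> is gained.\<close>

lemma contraction_arith:
  fixes \<kappa> l B R \<beta> \<theta> W e :: real
  assumes "0 < \<kappa>" "\<kappa> \<le> 1" "0 \<le> l" "l < 1" "1 \<le> B"
    and \<beta>: "\<beta> = \<kappa> / (4 * B)" and \<theta>: "\<theta> = (1 - l) * \<kappa> / 4" and W: "0 \<le> W" and A: "0 \<le> A"
    and D1: "D \<le> A * (1 + \<beta> * l * W + 2 * \<beta> * B)"
    and D2: "W \<le> 4 * B / (1 - l) \<Longrightarrow> D \<le> A * (1 + \<beta> * l * W + 2 * \<beta> * B - \<kappa>) + \<kappa> * e"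
    and e: "0 \<le> e"
  shows "D \<le> (1 - \<theta>) * (A * (1 + \<beta> * W)) + \<kappa> * e"
proof -
  have \<beta>B: "2 * \<beta> * B = \<kappa> / 2" and \<beta>0: "0 < \<beta>" using assms by (auto simp: \<beta>)
  define t where "t = (1 - l) * (\<beta> * W)"
  have t0: "0 \<le> t" using \<beta>0 W assms(4) by (simp add: t_def)
  have \<theta>t: "\<theta> * (\<beta> * W) = \<kappa> / 4 * t" by (simp add: \<theta> t_def)
  have \<kappa>t: "\<kappa> / 4 * t \<le> t / 4" using t0 assms(2) mult_right_mono[of \<kappa> 1 t] by simp
  have \<theta>\<kappa>: "\<theta> \<le> \<kappa> / 4"
    using assms(1,3) mult_right_mono[of "1 - l" 1 \<kappa>] by (simp add: \<theta>)
  have lW: "\<beta> * l * W = \<beta> * W - t" by (simp add: t_def algebra_simps)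
  show ?thesis
  proof (cases "W \<le> 4 * B / (1 - l)")
    case True
    have "1 + \<beta> * l * W + 2 * \<beta> * B - \<kappa> \<le> (1 - \<theta>) * (1 + \<beta> * W)"
      using \<theta>t \<kappa>t \<theta>\<kappa> t0 assms(1) unfolding \<beta>B lW by (simp add: algebra_simps)
    from mult_left_mono[OF this A] D2[OF True] show ?thesis by (simp add: mult.left_commute)
  next
    case False
    then have "4 * B \<le> (1 - l) * W" using assms(4) by (simp add: field_simps)
    from mult_left_mono[OF this, of \<beta>] \<beta>0 \<beta>B have "\<kappa> \<le> t" by (simp add: t_def algebra_simps)
    then have "1 + \<beta> * l * W + 2 * \<beta> * B \<le> (1 - \<theta>) * (1 + \<beta> * W)"
      using \<theta>t \<kappa>t \<theta>\<kappa> t0 unfolding \<beta>B lW by (simp add: algebra_simps)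
    from mult_left_mono[OF this A] D1 assms(1) e have "D \<le> A * ((1 - \<theta>) * (1 + \<beta> * W))" "0 \<le> \<kappa> * e"
      by auto
    then show ?thesis by (simp add: mult.left_commute)
  qed
qed

text \<open>The estimates below hold with the same constants for all these functions at once, and
  every element of \<open>blip\<close> is a positive multiple of one of them.\<close>

definition blip1 :: "('a::metric_space \<Rightarrow> real) set" where
  "blip1 = {f. (\<forall>x. \<bar>f x\<bar> \<le> 1) \<and> (\<forall>x y. \<bar>f x - f y\<bar> \<le> dist x y)}"

locale contractive_ifs = iterated_function_system N w p + modulus_couple r \<omega>
  for N and w :: "nat \<Rightarrow> 'a::metric_space \<Rightarrow> 'a" and p and r \<omega> +
  fixes k :: nat and c \<delta> :: real and x\<^sub>0 :: 'a
  assumes contr: "(\<Sum>i=1..N. p i x * dist (w i x) (w i y)) \<le> r (dist x y)"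
    and p_cont: "(\<Sum>i=1..N. \<bar>p i x - p i y\<bar>) \<le> \<omega> (dist x y)"
    and k: "k \<in> {1..N}" and c: "0 \<le> c" "c < 1" and wk: "dist (w k x) (w k y) \<le> c * dist x y"
    and \<delta>: "0 < \<delta>" "\<delta> \<le> p k x"
begin

section \<open>Equicontinuity, drift and coupling\<close>

abbreviation V where "V x \<equiv> dist x x\<^sub>0"

text \<open>The difference splits into a part with moved points, weighted by \<open>p i x\<close>,
  and a part with changed weights. Jensen's inequality for the concave \<open>h\<close> reduces the
  first to the average distance, which \<open>contr\<close> bounds; the second is at most
  \<open>\<omega>\<close> because \<open>g\<close> is bounded by 1.\<close>

lemma P_modulus:
  assumes g: "\<And>x. \<bar>g x\<bar> \<le> 1" "\<And>x y. \<bar>g x - g y\<bar> \<le> h (dist x y)"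
    and h: "concave_on {0..} h" "mono_on {0..} h"
  shows "\<bar>P g x - P g y\<bar> \<le> h (r (dist x y)) + \<omega> (dist x y)"
proof -
  have "P g x - P g y = (\<Sum>i=1..N. (g (w i x) - g (w i y)) * p i x) + (\<Sum>i=1..N. g (w i y) * (p i x - p i y))"
    unfolding trans_op_def sum_subtractf[symmetric] sum.distrib[symmetric]
    by (rule sum.cong) (simp_all add: algebra_simps)
  also have "\<bar>\<dots>\<bar> \<le> (\<Sum>i=1..N. \<bar>(g (w i x) - g (w i y)) * p i x\<bar>) + (\<Sum>i=1..N. \<bar>g (w i y) * (p i x - p i y)\<bar>)"
    by (intro order_trans[OF abs_triangle_ineq] add_mono sum_abs)
  also have "\<dots> \<le> (\<Sum>i=1..N. p i x * h (dist (w i x) (w i y))) + (\<Sum>i=1..N. \<bar>p i x - p i y\<bar>)"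
  proof (intro add_mono sum_mono)
    fix i assume i: "i \<in> {1..N}"
    show "\<bar>(g (w i x) - g (w i y)) * p i x\<bar> \<le> p i x * h (dist (w i x) (w i y))"
      using mult_left_mono[OF g(2)[of "w i x" "w i y"] p_nonneg[OF i, of x]] p_nonneg[OF i, of x]
      by (simp add: abs_mult mult.commute[of "p i x"])
    show "\<bar>g (w i y) * (p i x - p i y)\<bar> \<le> \<bar>p i x - p i y\<bar>"
      using g(1)[of "w i y"] by (simp add: abs_mult mult_left_le_one_le)
  qed
  also have "(\<Sum>i=1..N. p i x * h (dist (w i x) (w i y))) \<le> h (\<Sum>i=1..N. p i x * dist (w i x) (w i y))"
    by (rule concave_on_sum_le[OF _ h(1) p_sum]) (use p_nonneg in simp_all)
  also have "\<dots> \<le> h (r (dist x y))"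
  proof (rule mono_onD[OF h(2) _ _ contr])
    have "0 \<le> (\<Sum>i=1..N. p i x * dist (w i x) (w i y))"
      by (intro sum_nonneg mult_nonneg_nonneg p_nonneg zero_le_dist)
    then show "(\<Sum>i=1..N. p i x * dist (w i x) (w i y)) \<in> {0..}" by simp
    show "r (dist x y) \<in> {0..}" using r_nonneg by simp
  qed
  finally show ?thesis using p_cont[of x y] by linarith
qed

lemma iter_modulus:
  assumes "f \<in> blip1"
  shows "\<bar>(P ^^ n) f x - (P ^^ n) f y\<bar> \<le> iter_modulus r \<omega> n (dist x y)"
proof (induction n arbitrary: x y)
  case 0
  show ?case using assms by (simp add: iter_modulus_0 blip1_def)
next
  case (Suc n)
  have "\<bar>(P ^^ n) f x\<bar> \<le> 1" for x using assms by (intro iter_abs_le) (simp add: blip1_def)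
  then have "\<bar>P ((P ^^ n) f) x - P ((P ^^ n) f) y\<bar>
      \<le> iter_modulus r \<omega> n (r (dist x y)) + \<omega> (dist x y)"
    using iter_modulus_concave_mono[of n] by (intro P_modulus Suc) auto
  then show ?case by (simp add: iter_modulus_Suc)
qed

lemma equicontinuous:
  assumes "0 < e"
  obtains d where "0 < d"
    "\<And>n f x y. f \<in> blip1 \<Longrightarrow> dist x y \<le> d \<Longrightarrow> \<bar>(P ^^ n) f x - (P ^^ n) f y\<bar> \<le> e"
proof -
  obtain d where d: "0 < d" "\<And>n t. 0 \<le> t \<Longrightarrow> t \<le> d \<Longrightarrow> iter_modulus r \<omega> n t \<le> e"
    using iter_modulus_small[OF assms] by blast
  show ?thesis
    by (rule that[OF d(1)]) (rule order_trans[OF iter_modulus d(2)], auto)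
qed

text \<open>A Foster-Lyapunov bound: \<open>contr\<close> with second point \<open>x\<^sub>0\<close>
  and the affine bound on \<open>r\<close> give \<open>P V x \<le> l * V x + b\<close>, which is
  iterated.\<close>

lemma drift:
  obtains l B where "0 \<le> l" "l < 1" "1 \<le> B" "\<And>n x. (P ^^ n) V x \<le> l ^ n * V x + B"
proof -
  obtain l s where ls: "0 \<le> l" "l < 1" "0 \<le> s" "\<And>t. 0 \<le> t \<Longrightarrow> r t \<le> l * t + s"
    using affine_bound by blast
  define b where "b = s + (\<Sum>i=1..N. dist (w i x\<^sub>0) x\<^sub>0)"
  have b0: "0 \<le> b" using ls by (auto simp: b_def intro!: add_nonneg_nonneg sum_nonneg)
  \<comment> \<open>\<open>b / (1 - l)\<close> is the fixed point of \<open>q = l * q + b\<close>;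
    the added 1 ensures \<open>1 \<le> B\<close>.\<close>
  define B where "B = b / (1 - l) + 1"
  have B: "1 \<le> B" "l * B + b \<le> B"
  proof -
    show "1 \<le> B" using b0 ls by (simp add: B_def)
    define q where "q = b / (1 - l)"
    have "b = (1 - l) * q" using ls by (simp add: q_def)
    moreover have "B = q + 1" by (simp add: B_def q_def)
    ultimately have "l * B + b = l + q" by (simp add: algebra_simps)
    then show "l * B + b \<le> B" using ls \<open>B = q + 1\<close> by simp
  qed
  have PV: "P V x \<le> l * V x + b" for x
  proof -
    have "P V x \<le> (\<Sum>i=1..N. p i x * dist (w i x) (w i x\<^sub>0) + dist (w i x\<^sub>0) x\<^sub>0)"
      unfolding trans_op_def
    proof (rule sum_mono)
      fix i assume i: "i \<in> {1..N}"
      have "V (w i x) * p i x \<le> (dist (w i x) (w i x\<^sub>0) + dist (w i x\<^sub>0) x\<^sub>0) * p i x"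
        by (intro mult_right_mono dist_triangle p_nonneg i)
      moreover have "dist (w i x\<^sub>0) x\<^sub>0 * p i x \<le> dist (w i x\<^sub>0) x\<^sub>0"
        using p_le_1[OF i, of x] p_nonneg[OF i, of x] by (intro mult_left_le) auto
      ultimately show "V (w i x) * p i x \<le> p i x * dist (w i x) (w i x\<^sub>0) + dist (w i x\<^sub>0) x\<^sub>0"
        by (simp add: algebra_simps)
    qed
    also have "\<dots> \<le> r (V x) + (\<Sum>i=1..N. dist (w i x\<^sub>0) x\<^sub>0)"
      using contr[of x x\<^sub>0] by (simp add: sum.distrib)
    also have "\<dots> \<le> l * V x + b" using ls(4)[of "V x"] by (simp add: b_def)
    finally show ?thesis .
  qed
  have "(P ^^ n) V x \<le> l ^ n * V x + B" for n x
  proof (induction n arbitrary: x)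
    case 0
    show ?case using B by simp
  next
    case (Suc n)
    have "(P ^^ Suc n) V x = (P ^^ n) (P V) x" by (simp add: funpow_swap1)
    also have "\<dots> \<le> (P ^^ n) (\<lambda>x. l * V x + b) x" by (rule iter_mono[OF PV])
    also have "\<dots> = l * (P ^^ n) V x + b" by (simp add: iter_add iter_cmult iter_const)
    also have "\<dots> \<le> l * (l ^ n * V x + B) + b" using Suc ls by (intro add_right_mono mult_left_mono) auto
    also have "\<dots> \<le> l ^ Suc n * V x + B" using B(2) by (simp add: algebra_simps)
    finally show ?case .
  qed
  then show ?thesis using that ls B by blast
qed

text \<open>Among the branches of the iterate, the one that chooses \<open>w k\<close> every time
  has weight at least \<open>\<delta> ^ m\<close>; the others contribute nonnegatively.\<close>

lemma iter_lower_bound: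
  assumes g: "\<And>x. 0 \<le> g x"
  shows "\<delta> ^ m * g ((w k ^^ m) x) \<le> (P ^^ m) g x"
proof (induction m arbitrary: x)
  case (Suc m)
  have gm: "0 \<le> (P ^^ m) g x" for x using g by (rule iter_nonneg)
  have "\<delta> ^ Suc m * g ((w k ^^ Suc m) x) = (\<delta> ^ m * g ((w k ^^ m) (w k x))) * \<delta>"
    by (simp add: funpow_swap1)
  also have "\<dots> \<le> (P ^^ m) g (w k x) * p k x"
    using Suc[of "w k x"] \<delta> gm by (intro mult_mono) auto
  also have "\<dots> \<le> P ((P ^^ m) g) x"
    unfolding trans_op_def[of N w p "(P ^^ m) g" x]
    using k gm p_nonneg by (intro member_le_sum[of k _ "\<lambda>i. (P ^^ m) g (w i x) * p i x"]) auto
  finally show ?case by simp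
qed simp

lemma wk_iterate: "dist ((w k ^^ m) x) ((w k ^^ m) y) \<le> c ^ m * dist x y"
proof (induction m)
  case (Suc m)
  have "dist ((w k ^^ Suc m) x) ((w k ^^ Suc m) y) \<le> c * (c ^ m * dist x y)"
    using order_trans[OF wk mult_left_mono[OF Suc c(1)]] by simp
  then show ?case by (simp add: mult.assoc)
qed simp

text \<open>A function whose oscillation is controlled by the sum of two weights stays within a weight of
  a constant; after subtracting the constant, the mass that both points send along \<open>w k ^^ m\<close> can be
  split off from the positive operator \<open>P ^^ m\<close>.\<close>

lemma oscillation_step:
  assumes s: "\<And>u v. g u - g v \<le> s u + s v"
  shows "(P ^^ m) g x - (P ^^ m) g y \<le> (P ^^ m) s x + (P ^^ m) s y
    - \<delta> ^ m * (s ((w k ^^ m) x) + s ((w k ^^ m) y))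
    + \<delta> ^ m * (g ((w k ^^ m) x) - g ((w k ^^ m) y))"
proof -
  obtain d where d: "\<And>u. \<bar>g u - d\<bar> \<le> s u" using oscillation_center[OF s] by metis
  have "0 \<le> s u - g u + d" "0 \<le> s u + g u - d" for u using d[of u] by auto
  from iter_lower_bound[of "\<lambda>u. s u - g u + d", OF this(1), of m x]
    iter_lower_bound[of "\<lambda>u. s u + g u - d", OF this(2), of m y]
  show ?thesis
    by (simp add: iter_add iter_diff iter_const algebra_simps)
qed

text \<open>Let \<open>A\<close> be the constant in the weighted oscillation bound \<open>G\<close>.
  Every further \<open>m\<close> steps replace \<open>A\<close> by
  \<open>(1 - \<theta>) * A + \<kappa> * \<epsilon>\<close>: points with small \<open>V\<close> are
  brought within \<open>d\<close> of each other by \<open>w k ^^ m\<close>, where equicontinuity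
  bounds the oscillation by \<open>\<epsilon>\<close>, and for large \<open>V\<close> the drift
  suffices. Since \<open>d\<close> serves all iterates and all \<open>f\<close> at once, the step
  can be repeated.\<close>

theorem merging:
  assumes e: "0 < e"
  obtains n\<^sub>0 where "\<And>n f x y. n\<^sub>0 \<le> n \<Longrightarrow> f \<in> blip1 \<Longrightarrow>
    \<bar>(P ^^ n) f x - (P ^^ n) f y\<bar> \<le> e * (1 + V x + V y)"
proof -
  obtain l B where l: "0 \<le> l" "l < 1" and B: "1 \<le> B"
    and dr: "\<And>n x. (P ^^ n) V x \<le> l ^ n * V x + B"
    using drift by blast
  \<comment> \<open>The recursion for \<open>A\<close> has the fixed point
    \<open>\<kappa> * \<epsilon> / \<theta> = 4 * \<epsilon> / (1 - l)\<close>; one more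
    \<open>\<epsilon>\<close> absorbs the transient, and the total is \<open>e\<close>.\<close>
  define \<epsilon> where "\<epsilon> = e / (1 + 4 / (1 - l))"
  have den: "0 < 1 + 4 / (1 - l)" using l by (intro add_pos_nonneg) auto
  have \<epsilon>: "0 < \<epsilon>" using e den by (simp add: \<epsilon>_def)
  obtain d where d: "0 < d"
    "\<And>n f x y. f \<in> blip1 \<Longrightarrow> dist x y \<le> d \<Longrightarrow> \<bar>(P ^^ n) f x - (P ^^ n) f y\<bar> \<le> \<epsilon>"
    using equicontinuous[OF \<epsilon>] by blast
  \<comment> \<open>The threshold for \<open>W\<close> in \<open>contraction_arith\<close>.\<close>
  define R where "R = 4 * B / (1 - l)"
  have R: "0 < R" using l B by (simp add: R_def)
  obtain m' where m': "c ^ m' < d / R"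
    using real_arch_pow_inv[of "d / R" c] c d R by auto
  \<comment> \<open>A positive exponent guarantees \<open>l ^ m \<le> l\<close>.\<close>
  define m where "m = Suc m'"
  have "c ^ m \<le> c ^ m'" using c by (intro power_decreasing) (auto simp: m_def)
  then have m: "c ^ m * R \<le> d" using m' R by (simp add: pos_less_divide_eq) (meson less_imp_le mult_right_mono order_trans)
  have lm: "l ^ m \<le> l" using power_decreasing[of 1 m l] l by (simp add: m_def)
  define \<kappa> where "\<kappa> = \<delta> ^ m"
  have "\<delta> \<le> 1" using \<delta>(2)[of x\<^sub>0] p_le_1[OF k, of x\<^sub>0] by linarith
  then have \<kappa>: "0 < \<kappa>" "\<kappa> \<le> 1" using \<delta>(1) by (auto simp: \<kappa>_def power_le_one)
  define \<beta> where "\<beta> = \<kappa> / (4 * B)"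
  have \<beta>: "0 < \<beta>" "\<beta> \<le> 1" using \<kappa> B by (auto simp: \<beta>_def field_simps)
  define \<theta> where "\<theta> = (1 - l) * \<kappa> / 4"
  have \<theta>: "0 < \<theta>" "\<theta> \<le> 1" using \<kappa> l mult_mono[of "1 - l" 1 \<kappa> 1] by (auto simp: \<theta>_def)
  define G where "G A \<longleftrightarrow> (\<exists>n\<^sub>0. \<forall>n\<ge>n\<^sub>0. \<forall>f\<in>blip1. \<forall>x y.
    \<bar>(P ^^ n) f x - (P ^^ n) f y\<bar> \<le> A * (1 + \<beta> * (V x + V y)))" for A
  have step: "(P ^^ m) g x - (P ^^ m) g y \<le> (1 - \<theta>) * (A * (1 + \<beta> * (V x + V y))) + \<kappa> * \<epsilon>"
    if A: "0 \<le> A" and g: "\<And>x y. \<bar>g x - g y\<bar> \<le> A * (1 + \<beta> * (V x + V y))"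
      and gd: "\<And>x y. dist x y \<le> d \<Longrightarrow> \<bar>g x - g y\<bar> \<le> \<epsilon>" for A g x y
  proof (rule contraction_arith[OF \<kappa> l B \<beta>_def \<theta>_def])
    \<comment> \<open>The constant is halved so that \<open>s u + s v\<close> is the full bound on
      the oscillation.\<close>
    define s where "s u = A * (1 / 2 + \<beta> * V u)" for u
    define X where "X = (w k ^^ m) x"
    define Y where "Y = (w k ^^ m) y"
    have sg: "g u - g v \<le> s u + s v" for u v using g[of u v] by (simp add: s_def algebra_simps)
    have Ps: "(P ^^ m) s u \<le> A * (1 / 2 + \<beta> * (l * V u + B))" for u
    proof -
      have "(P ^^ m) s u = A * (1 / 2 + \<beta> * (P ^^ m) V u)"
        unfolding s_def[abs_def] by (simp only: iter_cmult iter_add iter_const)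
      also have "(P ^^ m) V u \<le> l * V u + B"
        using dr[of m u] mult_right_mono[OF lm, of "V u"] by simp
      finally show ?thesis using A \<beta> by (simp add: mult_left_mono)
    qed
    have Psxy: "(P ^^ m) s x + (P ^^ m) s y \<le> A * (1 + \<beta> * l * (V x + V y) + 2 * \<beta> * B)"
      using Ps[of x] Ps[of y] by (simp add: algebra_simps)
    have main: "(P ^^ m) g x - (P ^^ m) g y \<le> A * (1 + \<beta> * l * (V x + V y) + 2 * \<beta> * B)
        - \<kappa> * (s X + s Y) + \<kappa> * (g X - g Y)"
      using oscillation_step[of g s m x y, OF sg] Psxy by (simp add: \<kappa>_def X_def Y_def)
    have "\<kappa> * (g X - g Y) \<le> \<kappa> * (s X + s Y)" using sg \<kappa> by simp
    with main show "(P ^^ m) g x - (P ^^ m) g y \<le> A * (1 + \<beta> * l * (V x + V y) + 2 * \<beta> * B)"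
      by linarith
    assume "V x + V y \<le> 4 * B / (1 - l)"
    then have W: "V x + V y \<le> R" by (simp add: R_def)
    have "dist X Y \<le> c ^ m * dist x y" unfolding X_def Y_def by (rule wk_iterate)
    also have "\<dots> \<le> c ^ m * R"
      using W dist_triangle2[of x y x\<^sub>0] c by (intro mult_left_mono) auto
    finally have "g X - g Y \<le> \<epsilon>" using gd[of X Y] m by linarith
    then have 1: "\<kappa> * (g X - g Y) \<le> \<kappa> * \<epsilon>" using \<kappa> by simp
    \<comment> \<open>Splitting off the common mass saves \<open>\<kappa> * (s X + s Y)\<close>; its
      constant part alone is worth \<open>\<kappa> * A\<close>.\<close>
    have "A \<le> s X + s Y" using A \<beta> by (simp add: s_def algebra_simps)
    then have 2: "\<kappa> * A \<le> \<kappa> * (s X + s Y)" using \<kappa> by simp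
    have 3: "A * (1 + \<beta> * l * (V x + V y) + 2 * \<beta> * B - \<kappa>)
        = A * (1 + \<beta> * l * (V x + V y) + 2 * \<beta> * B) - \<kappa> * A" by (simp add: algebra_simps)
    show "(P ^^ m) g x - (P ^^ m) g y
        \<le> A * (1 + \<beta> * l * (V x + V y) + 2 * \<beta> * B - \<kappa>) + \<kappa> * \<epsilon>"
      unfolding 3 using main 1 2 by linarith
  qed (use A \<epsilon> in auto)
  have G_step: "G ((1 - \<theta>) * A + \<kappa> * \<epsilon>)" if A: "0 \<le> A" and GA: "G A" for A
  proof -
    obtain n\<^sub>0 where n\<^sub>0: "\<And>n f x y. n\<^sub>0 \<le> n \<Longrightarrow> f \<in> blip1 \<Longrightarrow>
        \<bar>(P ^^ n) f x - (P ^^ n) f y\<bar> \<le> A * (1 + \<beta> * (V x + V y))"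
      using GA unfolding G_def by blast
    have "\<bar>(P ^^ n) f x - (P ^^ n) f y\<bar> \<le> ((1 - \<theta>) * A + \<kappa> * \<epsilon>) * (1 + \<beta> * (V x + V y))"
      if n: "n\<^sub>0 + m \<le> n" and f: "f \<in> blip1" for n f x y
    proof -
      define g where "g = (P ^^ (n - m)) f"
      have n': "n = m + (n - m)" using n by simp
      have eq: "(P ^^ n) f = (P ^^ m) g" unfolding g_def by (subst n') (simp only: funpow_add comp_def)
      have st: "(P ^^ m) g x - (P ^^ m) g y \<le> (1 - \<theta>) * (A * (1 + \<beta> * (V x + V y))) + \<kappa> * \<epsilon>" for x y
      proof (rule step[OF A])
        show "\<bar>g x - g y\<bar> \<le> A * (1 + \<beta> * (V x + V y))" for x y
          unfolding g_def by (rule n\<^sub>0[OF _ f]) (use n in simp)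
        show "\<bar>g x - g y\<bar> \<le> \<epsilon>" if "dist x y \<le> d" for x y
          unfolding g_def by (rule d(2)[OF f that])
      qed
      have "\<kappa> * \<epsilon> * 1 \<le> \<kappa> * \<epsilon> * (1 + \<beta> * (V x + V y))"
        using \<kappa> \<epsilon> \<beta> by (intro mult_left_mono) auto
      then show ?thesis
        using st[of x y] st[of y x] unfolding eq by (simp add: abs_le_iff algebra_simps)
    qed
    then show ?thesis unfolding G_def by blast
  qed
  \<comment> \<open>The distance to the fixed point shrinks by the factor
    \<open>1 - \<theta>\<close> at each step, starting from the trivial bound 2.\<close>
  have G_iter: "G (2 * (1 - \<theta>) ^ j + \<epsilon> * (4 / (1 - l)))" for j
  proof (induction j)
    case 0
    have "\<bar>(P ^^ n) f x - (P ^^ n) f y\<bar> \<le> (2 + \<epsilon> * (4 / (1 - l))) * (1 + \<beta> * (V x + V y))"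
      if f: "f \<in> blip1" for n f x y
    proof -
      have "\<bar>(P ^^ n) f x\<bar> \<le> 1" for x using f by (intro iter_abs_le) (simp add: blip1_def)
      from this[of x] this[of y] have "\<bar>(P ^^ n) f x - (P ^^ n) f y\<bar> \<le> 2 * 1" by linarith
      also have "\<dots> \<le> (2 + \<epsilon> * (4 / (1 - l))) * (1 + \<beta> * (V x + V y))"
        using \<epsilon> l \<beta> by (intro mult_mono) auto
      finally show ?thesis .
    qed
    then show ?case by (auto simp: G_def)
  next
    case (Suc j)
    have "\<theta> * (\<epsilon> * (4 / (1 - l))) = \<kappa> * \<epsilon>" using l by (simp add: \<theta>_def)
    moreover have "(1 - \<theta>) * (2 * a + q) + \<kappa> * \<epsilon> = 2 * ((1 - \<theta>) * a) + q"
      if "\<theta> * q = \<kappa> * \<epsilon>" for a q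
      using that by (simp add: algebra_simps)
    ultimately have "(1 - \<theta>) * (2 * (1 - \<theta>) ^ j + \<epsilon> * (4 / (1 - l))) + \<kappa> * \<epsilon>
        = 2 * (1 - \<theta>) ^ Suc j + \<epsilon> * (4 / (1 - l))"
      unfolding power_Suc by blast
    with G_step[OF _ Suc] show ?case using \<theta> \<epsilon> l by simp
  qed
  obtain j where j: "(1 - \<theta>) ^ j < \<epsilon> / 2"
    using real_arch_pow_inv[of "\<epsilon> / 2" "1 - \<theta>"] \<epsilon> \<theta> by auto
  obtain n\<^sub>0 where n\<^sub>0: "\<And>n f x y. n\<^sub>0 \<le> n \<Longrightarrow> f \<in> blip1 \<Longrightarrow>
      \<bar>(P ^^ n) f x - (P ^^ n) f y\<bar> \<le> (2 * (1 - \<theta>) ^ j + \<epsilon> * (4 / (1 - l))) * (1 + \<beta> * (V x + V y))"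
    using G_iter[of j] unfolding G_def by blast
  show ?thesis
  proof (rule that)
    fix n and f :: "'a \<Rightarrow> real" and x y assume "n\<^sub>0 \<le> n" "f \<in> blip1"
    then have "\<bar>(P ^^ n) f x - (P ^^ n) f y\<bar>
        \<le> (2 * (1 - \<theta>) ^ j + \<epsilon> * (4 / (1 - l))) * (1 + \<beta> * (V x + V y))" by (rule n\<^sub>0)
    also have "\<dots> \<le> e * (1 + (V x + V y))"
    proof (intro mult_mono add_left_mono)
      have "e = \<epsilon> * (1 + 4 / (1 - l))" using den by (simp add: \<epsilon>_def)
      then show "2 * (1 - \<theta>) ^ j + \<epsilon> * (4 / (1 - l)) \<le> e" using j by (simp add: distrib_left)
      show "\<beta> * (V x + V y) \<le> V x + V y" using \<beta> by (intro mult_left_le_one_le) auto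
    qed (use e \<beta> in auto)
    finally show "\<bar>(P ^^ n) f x - (P ^^ n) f y\<bar> \<le> e * (1 + V x + V y)" by (simp add: add.assoc)
  qed
qed

text \<open>With \<open>g = (P ^^ n) f\<close>, the difference is the average under
  \<open>P ^^ m\<close> of \<open>g u - g x\<close>. Merging bounds this by a multiple of
  \<open>1 + V u + V x\<close>, and the drift bounds the average of \<open>V\<close> uniformly in
  \<open>m\<close>.\<close>

lemma uniform_Cauchy:
  assumes e: "0 < e"
  obtains n\<^sub>0 where "\<And>n m f x. n\<^sub>0 \<le> n \<Longrightarrow> f \<in> blip1 \<Longrightarrow>
    \<bar>(P ^^ (m + n)) f x - (P ^^ n) f x\<bar> \<le> e * (1 + V x)"
proof -
  obtain l B where l: "0 \<le> l" "l < 1" and B: "1 \<le> B"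
    and dr: "\<And>n x. (P ^^ n) V x \<le> l ^ n * V x + B"
    using drift by blast
  \<comment> \<open>With this value as \<open>q\<close>, the bounds add up to
    \<open>q * (1 + B + 2 * V x)\<close>, which is at most \<open>e * (1 + V x)\<close>.\<close>
  have e': "0 < e / (2 + B)" using e B by simp
  obtain n\<^sub>0 where n\<^sub>0: "\<And>n f x y. n\<^sub>0 \<le> n \<Longrightarrow> f \<in> blip1 \<Longrightarrow>
      \<bar>(P ^^ n) f x - (P ^^ n) f y\<bar> \<le> e / (2 + B) * (1 + V x + V y)"
    using merging[OF e'] by blast
  show ?thesis
  proof (rule that)
    fix n m and f :: "'a \<Rightarrow> real" and x assume n: "n\<^sub>0 \<le> n" and f: "f \<in> blip1"
    define g where "g = (P ^^ n) f"
    define q where "q = e / (2 + B)"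
    have q: "0 < q" "q * (2 + B) = e" using e' B by (auto simp: q_def)
    have "\<bar>(P ^^ m) (\<lambda>u. g u - g x) x\<bar> \<le> (P ^^ m) (\<lambda>u. q * (1 + V x) + q * V u) x"
    proof -
      have b: "\<bar>g u - g x\<bar> \<le> q * (1 + V x) + q * V u" for u
        using n\<^sub>0[OF n f, of u x] unfolding q_def[symmetric] by (simp add: g_def algebra_simps)
      have "(P ^^ m) (\<lambda>u. g u - g x) x \<le> (P ^^ m) (\<lambda>u. q * (1 + V x) + q * V u) x"
        by (rule iter_mono) (use b abs_le_D1 in blast)
      moreover have "(P ^^ m) (\<lambda>u. (-1) * (g u - g x)) x \<le> (P ^^ m) (\<lambda>u. q * (1 + V x) + q * V u) x"
        by (rule iter_mono) (use b abs_le_D2 in fastforce)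
      ultimately show ?thesis unfolding iter_cmult by simp
    qed
    also have "\<dots> = q * (1 + V x) + q * (P ^^ m) V x" by (simp only: iter_add iter_cmult iter_const)
    also have "\<dots> \<le> q * (1 + V x) + q * (V x + B)"
    proof (intro add_left_mono mult_left_mono)
      have "l ^ m * V x \<le> V x" using l by (intro mult_left_le_one_le) (auto simp: power_le_one)
      then show "(P ^^ m) V x \<le> V x + B" using dr[of m x] by linarith
    qed (use q in simp)
    also have "\<dots> = q * (1 + B + 2 * V x)" by (simp add: algebra_simps)
    also have "\<dots> \<le> q * ((2 + B) * (1 + V x))"
    proof (rule mult_left_mono)
      have "0 \<le> B * V x" using B by simp
      then show "1 + B + 2 * V x \<le> (2 + B) * (1 + V x)" by (simp add: algebra_simps)
    qed (use q in simp)
    also have "\<dots> = e * (1 + V x)" using q(2) by (metis mult.assoc)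
    finally show "\<bar>(P ^^ (m + n)) f x - (P ^^ n) f x\<bar> \<le> e * (1 + V x)"
      by (simp add: funpow_add iter_diff iter_const g_def)
  qed
qed

section \<open>The limit functional\<close>

definition limit_mean :: "('a \<Rightarrow> real) \<Rightarrow> real" where
  "limit_mean f = lim (\<lambda>n. (P ^^ n) f x\<^sub>0)"

lemma blip_scaled:
  assumes "f \<in> blip"
  obtains C g where "0 < C" "g \<in> blip1" "f = (\<lambda>x. C * g x)"
proof -
  obtain B L where f: "0 \<le> B" "0 \<le> L" "\<And>x. \<bar>f x\<bar> \<le> B" "\<And>x y. \<bar>f x - f y\<bar> \<le> L * dist x y"
    using blipE[OF assms] by metis
  define C where "C = B + L + 1"
  have C: "0 < C" using f by (simp add: C_def)
  show ?thesis
  proof (rule that[OF C])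
    have "\<bar>f x\<bar> \<le> C" for x using f(1,2) f(3)[of x] by (simp add: C_def)
    moreover have "\<bar>f x - f y\<bar> \<le> C * dist x y" for x y
      using f(1,2) order_trans[OF f(4) mult_right_mono[of L C "dist x y"]] by (simp add: C_def)
    ultimately show "(\<lambda>x. f x / C) \<in> blip1"
      using C by (auto simp: blip1_def diff_divide_distrib[symmetric] field_simps)
    show "f = (\<lambda>x. C * (f x / C))" using C by simp
  qed
qed

lemma limit_mean_tendsto:
  assumes f: "f \<in> blip"
  shows "(\<lambda>n. (P ^^ n) f x\<^sub>0) \<longlonglongrightarrow> limit_mean f"
proof -
  obtain C g where g: "0 < C" "g \<in> blip1" "f = (\<lambda>x. C * g x)" using blip_scaled[OF f] .
  have "Cauchy (\<lambda>n. (P ^^ n) g x\<^sub>0)"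
  proof (rule metric_CauchyI)
    fix e :: real assume "0 < e"
    then obtain n\<^sub>0 where n\<^sub>0: "\<And>n m f x. n\<^sub>0 \<le> n \<Longrightarrow> f \<in> blip1 \<Longrightarrow>
        \<bar>(P ^^ (m + n)) f x - (P ^^ n) f x\<bar> \<le> e / 3 * (1 + V x)"
      using uniform_Cauchy[of "e / 3"] by (metis divide_pos_pos zero_less_numeral)
    \<comment> \<open>\<open>V\<close> vanishes at the base point, so comparison with index
      \<open>n\<^sub>0\<close> costs \<open>e / 3\<close> for each of two indices.\<close>
    have *: "\<bar>(P ^^ n) g x\<^sub>0 - (P ^^ n\<^sub>0) g x\<^sub>0\<bar> \<le> e / 3" if "n\<^sub>0 \<le> n" for n
      using n\<^sub>0[of n\<^sub>0 g "n - n\<^sub>0" x\<^sub>0] g that by simp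
    have "dist ((P ^^ m) g x\<^sub>0) ((P ^^ n) g x\<^sub>0) < e" if "n\<^sub>0 \<le> m" "n\<^sub>0 \<le> n" for m n
      using *[OF that(1)] *[OF that(2)] \<open>0 < e\<close> unfolding dist_real_def by linarith
    then show "\<exists>M. \<forall>m\<ge>M. \<forall>n\<ge>M. dist ((P ^^ m) g x\<^sub>0) ((P ^^ n) g x\<^sub>0) < e" by blast
  qed
  then have "convergent (\<lambda>n. (P ^^ n) g x\<^sub>0)" by (rule real_Cauchy_convergent)
  then have "convergent (\<lambda>n. (P ^^ n) f x\<^sub>0)"
    using g by (simp add: iter_cmult convergent_mult_const_iff)
  then show ?thesis unfolding limit_mean_def by (simp add: convergent_LIMSEQ_iff)
qed

text \<open>Merging spreads convergence at the base point to all points; the error is weighted by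
  \<open>V\<close>, so it is uniform on bounded sets.\<close>

lemma blip_convergence:
  assumes f: "f \<in> blip" and e: "0 < e"
  obtains n\<^sub>0 where "\<And>n x. n\<^sub>0 \<le> n \<Longrightarrow> \<bar>(P ^^ n) f x - limit_mean f\<bar> \<le> e * (1 + V x)"
proof -
  obtain C g where g: "0 < C" "g \<in> blip1" "f = (\<lambda>x. C * g x)" using blip_scaled[OF f] .
  have "0 < e / (2 * C)" using e g by simp
  then obtain n\<^sub>1 where n\<^sub>1: "\<And>n f x y. n\<^sub>1 \<le> n \<Longrightarrow> f \<in> blip1 \<Longrightarrow>
      \<bar>(P ^^ n) f x - (P ^^ n) f y\<bar> \<le> e / (2 * C) * (1 + V x + V y)"
    using merging by blast
  obtain n\<^sub>2 where n\<^sub>2: "\<And>n. n\<^sub>2 \<le> n \<Longrightarrow> \<bar>(P ^^ n) f x\<^sub>0 - limit_mean f\<bar> < e / 2"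
    using LIMSEQ_D[OF limit_mean_tendsto[OF f], of "e / 2"] e by auto
  show ?thesis
  proof (rule that)
    fix n x assume n: "max n\<^sub>1 n\<^sub>2 \<le> n"
    have "\<bar>(P ^^ n) f x - (P ^^ n) f x\<^sub>0\<bar> = C * \<bar>(P ^^ n) g x - (P ^^ n) g x\<^sub>0\<bar>"
      using g by (simp add: iter_cmult abs_mult flip: right_diff_distrib)
    also have "\<dots> \<le> C * (e / (2 * C) * (1 + V x + V x\<^sub>0))"
      using n g n\<^sub>1[of n g x x\<^sub>0] by (intro mult_left_mono) auto
    also have "\<dots> = e / 2 * (1 + V x)" using g by simp
    finally have "\<bar>(P ^^ n) f x - limit_mean f\<bar> \<le> e / 2 * (1 + V x) + e / 2"
      using n\<^sub>2[of n] n by linarith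
    also have "\<dots> \<le> e * (1 + V x)" using e by (simp add: field_simps)
    finally show "\<bar>(P ^^ n) f x - limit_mean f\<bar> \<le> e * (1 + V x)" .
  qed
qed

lemma blip_mean_limit_mean: "blip_mean limit_mean"
proof
  fix f g :: "'a \<Rightarrow> real" assume fg: "f \<in> blip" "g \<in> blip"
  have "(\<lambda>n. (P ^^ n) (\<lambda>x. f x + g x) x\<^sub>0) \<longlonglongrightarrow> limit_mean f + limit_mean g"
    unfolding iter_add by (intro tendsto_add limit_mean_tendsto fg)
  then show "limit_mean (\<lambda>x. f x + g x) = limit_mean f + limit_mean g"
    using limit_mean_tendsto[OF blip_add[OF fg]] by (rule LIMSEQ_unique[symmetric])
next
  fix f :: "'a \<Rightarrow> real" and c :: real assume f: "f \<in> blip"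
  have "(\<lambda>n. (P ^^ n) (\<lambda>x. c * f x) x\<^sub>0) \<longlonglongrightarrow> c * limit_mean f"
    unfolding iter_cmult by (intro tendsto_mult_left limit_mean_tendsto f)
  then show "limit_mean (\<lambda>x. c * f x) = c * limit_mean f"
    using limit_mean_tendsto[OF blip_mult[OF blip_const f]] by (rule LIMSEQ_unique[symmetric])
next
  fix f :: "'a \<Rightarrow> real" assume f: "f \<in> blip" "\<And>x. 0 \<le> f x"
  show "0 \<le> limit_mean f"
    by (rule LIMSEQ_le_const[OF limit_mean_tendsto[OF f(1)]]) (use iter_nonneg[OF f(2)] in auto)
next
  show "limit_mean (\<lambda>x. 1) = 1" by (simp add: limit_mean_def iter_const)
qed

text \<open>The order of choices matters: \<open>uniform_Cauchy\<close> provides one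
  \<open>n\<^sub>0\<close> for all of \<open>blip1\<close>, so \<open>F\<close> may depend on
  \<open>n\<^sub>0\<close> and the cut-off on \<open>F\<close>. The cut-off vanishes on
  \<open>F\<close>, so its iterate of order \<open>n\<^sub>0\<close> is 0 at the base point and
  later ones are at most \<open>e\<close> there.\<close>

lemma limit_mean_tight:
  assumes e: "0 < e"
  shows "\<exists>F. finite F \<and> F \<noteq> {} \<and> limit_mean (\<lambda>x. min 1 (infdist x F)) \<le> e"
proof -
  obtain n\<^sub>0 where n\<^sub>0: "\<And>n m f x. n\<^sub>0 \<le> n \<Longrightarrow> f \<in> blip1 \<Longrightarrow>
      \<bar>(P ^^ (m + n)) f x - (P ^^ n) f x\<bar> \<le> e * (1 + V x)"
    using uniform_Cauchy[OF e] by blast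
  obtain F where F: "finite F" "F \<noteq> {}" "\<And>f. (\<forall>y\<in>F. f y = 0) \<Longrightarrow> (P ^^ n\<^sub>0) f x\<^sub>0 = 0"
    using iter_eq_0_on_finite[of n\<^sub>0 x\<^sub>0] by blast
  define f where "f x = min 1 (infdist x F)" for x
  have f1: "f \<in> blip1"
    unfolding blip1_def
  proof (intro CollectI conjI allI)
    show "\<bar>f x\<bar> \<le> 1" for x using infdist_nonneg[of x F] by (auto simp: f_def)
    show "\<bar>f x - f y\<bar> \<le> dist x y" for x y
      using infdist_triangle_abs[of x F y] by (auto simp: f_def)
  qed
  have fb: "f \<in> blip" using blip_infdist[of 1 F] by (simp add: f_def[abs_def])
  have "(P ^^ n\<^sub>0) f x\<^sub>0 = 0" by (rule F) (simp add: f_def)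
  then have "(P ^^ n) f x\<^sub>0 \<le> e" if "n\<^sub>0 \<le> n" for n
    using n\<^sub>0[of n\<^sub>0 f "n - n\<^sub>0" x\<^sub>0] f1 that by simp
  then have "limit_mean f \<le> e"
    by (intro LIMSEQ_le_const2[OF limit_mean_tendsto[OF fb]]) blast
  then show ?thesis using F by (auto simp: f_def[abs_def])
qed

section \<open>Convergence for bounded continuous functions\<close>

lemma bounded_convergence_below:
  fixes \<phi> :: "'a \<Rightarrow> real"
  assumes mu: "\<mu> \<in> borel_prob" and rep: "\<And>f. f \<in> blip \<Longrightarrow> (\<integral>x. f x \<partial>\<mu>) = limit_mean f"
    and \<phi>: "continuous_on UNIV \<phi>" "\<And>x. \<bar>\<phi> x\<bar> \<le> B" and R: "0 \<le> R" and e: "0 < e"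
  obtains n\<^sub>0 where "\<And>n x. n\<^sub>0 \<le> n \<Longrightarrow> V x \<le> R \<Longrightarrow> (\<integral>x. \<phi> x \<partial>\<mu>) - e \<le> (P ^^ n) \<phi> x"
proof -
  obtain F where F: "\<And>n. F n \<in> blip" "\<And>n x. F n x \<le> \<phi> x" "\<And>n x. \<bar>F n x\<bar> \<le> B"
    "\<And>x. (\<lambda>n. F n x) \<longlonglongrightarrow> \<phi> x"
    using blip_approx_below[OF \<phi>] by auto
  have "(\<lambda>n. \<integral>x. F n x \<partial>\<mu>) \<longlonglongrightarrow> (\<integral>x. \<phi> x \<partial>\<mu>)"
    by (rule borel_prob_dominated_convergence[OF mu blip_measurable[OF F(1)] _ F(3,4)])
      (rule borel_measurable_continuous_onI[OF \<phi>(1)])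
  from LIMSEQ_D[OF this, of "e / 2"] e obtain j
    where j: "\<bar>(\<integral>x. F j x \<partial>\<mu>) - (\<integral>x. \<phi> x \<partial>\<mu>)\<bar> < e / 2" by fastforce
  \<comment> \<open>The weight \<open>1 + V x\<close> is at most \<open>1 + R\<close> on the ball
    considered.\<close>
  have "0 < e / (2 * (1 + R))" using e R by simp
  then obtain n\<^sub>0 where n\<^sub>0: "\<And>n x. n\<^sub>0 \<le> n \<Longrightarrow>
      \<bar>(P ^^ n) (F j) x - limit_mean (F j)\<bar> \<le> e / (2 * (1 + R)) * (1 + V x)"
    using blip_convergence[OF F(1)] by blast
  show ?thesis
  proof (rule that)
    fix n x assume n: "n\<^sub>0 \<le> n" and x: "V x \<le> R"
    have "e / (2 * (1 + R)) * (1 + V x) \<le> e / (2 * (1 + R)) * (1 + R)"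
      using x e R by (intro mult_left_mono) auto
    also have "\<dots> = e / 2" using R by (simp add: field_simps)
    finally have "(\<integral>x. F j x \<partial>\<mu>) - e / 2 \<le> (P ^^ n) (F j) x"
      using n\<^sub>0[OF n, of x] rep[OF F(1), of j] by linarith
    moreover have "(P ^^ n) (F j) x \<le> (P ^^ n) \<phi> x" by (rule iter_mono[OF F(2)])
    ultimately show "(\<integral>x. \<phi> x \<partial>\<mu>) - e \<le> (P ^^ n) \<phi> x" using j by linarith
  qed
qed

text \<open>Approximation from below gives only a lower bound; the same bound for
  \<open>- \<phi>\<close> gives the upper one.\<close>

lemma bounded_convergence:
  fixes \<phi> :: "'a \<Rightarrow> real"
  assumes mu: "\<mu> \<in> borel_prob" and rep: "\<And>f. f \<in> blip \<Longrightarrow> (\<integral>x. f x \<partial>\<mu>) = limit_mean f"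
    and \<phi>: "continuous_on UNIV \<phi>" "\<And>x. \<bar>\<phi> x\<bar> \<le> B" and R: "0 \<le> R" and e: "0 < e"
  obtains n\<^sub>0 where "\<And>n x. n\<^sub>0 \<le> n \<Longrightarrow> V x \<le> R \<Longrightarrow> \<bar>(P ^^ n) \<phi> x - (\<integral>x. \<phi> x \<partial>\<mu>)\<bar> \<le> e"
proof -
  have \<phi>': "continuous_on UNIV (\<lambda>x. - \<phi> x)" "\<And>x. \<bar>- \<phi> x\<bar> \<le> B"
    using \<phi> by (auto intro: continuous_on_minus)
  obtain n\<^sub>1 where n\<^sub>1: "\<And>n x. n\<^sub>1 \<le> n \<Longrightarrow> V x \<le> R \<Longrightarrow> (\<integral>x. \<phi> x \<partial>\<mu>) - e \<le> (P ^^ n) \<phi> x"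
    using bounded_convergence_below[OF mu rep \<phi> R e] by blast
  obtain n\<^sub>2 where n\<^sub>2: "\<And>n x. n\<^sub>2 \<le> n \<Longrightarrow> V x \<le> R \<Longrightarrow>
      (\<integral>x. - \<phi> x \<partial>\<mu>) - e \<le> (P ^^ n) (\<lambda>x. - \<phi> x) x"
    using bounded_convergence_below[OF mu rep \<phi>' R e] by blast
  have neg: "(P ^^ n) (\<lambda>x. - \<phi> x) x = - (P ^^ n) \<phi> x" for n x
    using iter_cmult[of n "-1" \<phi>] by simp
  show ?thesis
  proof (rule that)
    fix n x assume n: "max n\<^sub>1 n\<^sub>2 \<le> n" and x: "V x \<le> R"
    have "(\<integral>x. \<phi> x \<partial>\<mu>) - e \<le> (P ^^ n) \<phi> x" using n\<^sub>1[of n x] n x by simp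
    moreover have "- (\<integral>x. \<phi> x \<partial>\<mu>) - e \<le> - (P ^^ n) \<phi> x"
      using n\<^sub>2[of n x] n x by (simp add: neg)
    ultimately show "\<bar>(P ^^ n) \<phi> x - (\<integral>x. \<phi> x \<partial>\<mu>)\<bar> \<le> e" by linarith
  qed
qed

lemma pointwise_convergence:
  fixes \<phi> :: "'a \<Rightarrow> real"
  assumes mu: "\<mu> \<in> borel_prob" and rep: "\<And>f. f \<in> blip \<Longrightarrow> (\<integral>x. f x \<partial>\<mu>) = limit_mean f"
    and \<phi>: "continuous_on UNIV \<phi>" "\<And>x. \<bar>\<phi> x\<bar> \<le> B"
  shows "(\<lambda>n. (P ^^ n) \<phi> x) \<longlonglongrightarrow> (\<integral>x. \<phi> x \<partial>\<mu>)"
proof (rule LIMSEQ_I)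
  fix e :: real assume "0 < e"
  then have "0 < e / 2" by simp
  then obtain n\<^sub>0 where n\<^sub>0: "\<And>n y. n\<^sub>0 \<le> n \<Longrightarrow> V y \<le> V x \<Longrightarrow>
      \<bar>(P ^^ n) \<phi> y - (\<integral>x. \<phi> x \<partial>\<mu>)\<bar> \<le> e / 2"
    using bounded_convergence[OF mu rep \<phi> zero_le_dist] by blast
  have "norm ((P ^^ n) \<phi> x - (\<integral>x. \<phi> x \<partial>\<mu>)) < e" if "n\<^sub>0 \<le> n" for n
    using n\<^sub>0[OF that order_refl] \<open>0 < e\<close> by simp
  then show "\<exists>n\<^sub>0. \<forall>n\<ge>n\<^sub>0. norm ((P ^^ n) \<phi> x - (\<integral>x. \<phi> x \<partial>\<mu>)) < e" by blast
qed

text \<open>\<open>(P ^^ n) (P f)\<close> is a shift of the sequence \<open>(P ^^ n) f\<close>, so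
  the two limits agree. \<open>P f\<close> is continuous but need not be Lipschitz, which is why
  convergence for continuous functions is invoked.\<close>

lemma limit_measure_stationary:
  assumes mu: "\<mu> \<in> borel_prob" and rep: "\<And>f. f \<in> blip \<Longrightarrow> (\<integral>x. f x \<partial>\<mu>) = limit_mean f"
  shows "dual_op P \<mu> = \<mu>"
proof (rule borel_prob_eqI[OF dual_op_borel_prob[OF ifs mu] mu])
  fix f :: "'a \<Rightarrow> real" assume f: "f \<in> blip"
  obtain B where B: "\<And>x. \<bar>f x\<bar> \<le> B" using blip_bounded[OF f] by blast
  have "(\<lambda>n. (P ^^ n) (P f) x\<^sub>0) \<longlonglongrightarrow> (\<integral>x. P f x \<partial>\<mu>)"
    using iter_continuous[OF blip_continuous[OF f], of 1] trans_op_abs_le[OF ifs B]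
    by (intro pointwise_convergence[OF mu rep]) auto
  moreover have "(\<lambda>n. (P ^^ Suc n) f x\<^sub>0) \<longlonglongrightarrow> limit_mean f"
    using limit_mean_tendsto[OF f] by (rule LIMSEQ_Suc)
  ultimately have "(\<integral>x. P f x \<partial>\<mu>) = limit_mean f"
    unfolding funpow_Suc_right comp_def by (rule LIMSEQ_unique)
  then show "(\<integral>x. f x \<partial>dual_op P \<mu>) = (\<integral>x. f x \<partial>\<mu>)"
    using integral_dual_op[OF ifs mu blip_measurable[OF f] B] rep[OF f] by simp
qed

text \<open>By duality the integrals are those of \<open>(P ^^ n) \<phi>\<close> against
  \<open>\<nu>\<close>, and these functions are uniformly bounded and converge pointwise to a
  constant.\<close>

lemma limit_measure_attracts:
  assumes mu: "\<mu> \<in> borel_prob" and rep: "\<And>f. f \<in> blip \<Longrightarrow> (\<integral>x. f x \<partial>\<mu>) = limit_mean f"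
    and nu: "\<nu> \<in> borel_prob"
  shows "weakly_converges (\<lambda>n. (dual_op P ^^ n) \<nu>) \<mu>"
  unfolding weakly_converges_def
proof
  fix \<phi> :: "'a \<Rightarrow> real" assume "\<phi> \<in> bcontfun"
  then have \<phi>: "continuous_on UNIV \<phi>" "bounded (range \<phi>)" by (auto simp: bcontfun_def)
  then obtain B where B: "\<And>x. \<bar>\<phi> x\<bar> \<le> B" by (auto simp: bounded_iff)
  have \<phi>m: "\<phi> \<in> borel_measurable borel" using \<phi>(1) by (rule borel_measurable_continuous_onI)
  have "(\<lambda>n. \<integral>x. (P ^^ n) \<phi> x \<partial>\<nu>) \<longlonglongrightarrow> (\<integral>x. (\<integral>y. \<phi> y \<partial>\<mu>) \<partial>\<nu>)"
  proof (rule borel_prob_dominated_convergence[OF nu])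
    show "(P ^^ n) \<phi> \<in> borel_measurable borel" for n
      using iter_continuous[OF \<phi>(1)] by (rule borel_measurable_continuous_onI)
    show "\<bar>(P ^^ n) \<phi> x\<bar> \<le> B" for n x by (rule iter_abs_le[OF B])
    show "(\<lambda>n. (P ^^ n) \<phi> x) \<longlonglongrightarrow> (\<integral>y. \<phi> y \<partial>\<mu>)" for x
      by (rule pointwise_convergence[OF mu rep \<phi>(1) B])
  qed simp
  then show "(\<lambda>n. \<integral>x. \<phi> x \<partial>(dual_op P ^^ n) \<nu>) \<longlonglongrightarrow> (\<integral>x. \<phi> x \<partial>\<mu>)"
    by (simp only: integral_dual_op_funpow[OF ifs nu \<phi>m B] borel_prob_integral_const[OF nu])
qed

text \<open>Compact sets are bounded, and convergence is uniform where \<open>V\<close> is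
  bounded.\<close>

lemma limit_measure_unif_compacts:
  assumes mu: "\<mu> \<in> borel_prob" and rep: "\<And>f. f \<in> blip \<Longrightarrow> (\<integral>x. f x \<partial>\<mu>) = limit_mean f"
  shows "weakly_converges_unif_compacts P \<mu>"
  unfolding weakly_converges_unif_compacts_def
proof (intro allI impI ballI)
  fix K :: "'a set" and \<phi> :: "'a \<Rightarrow> real" assume K: "compact K \<and> K \<noteq> {}" and "\<phi> \<in> bcontfun"
  then have \<phi>: "continuous_on UNIV \<phi>" "bounded (range \<phi>)" by (auto simp: bcontfun_def)
  then obtain B where B: "\<And>x. \<bar>\<phi> x\<bar> \<le> B" by (auto simp: bounded_iff)
  obtain R where R: "\<And>x. x \<in> K \<Longrightarrow> dist x\<^sub>0 x \<le> R"
    using compact_imp_bounded[of K] K unfolding bounded_any_center[of K x\<^sub>0] by blast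
  obtain z where z: "z \<in> K" using K by blast
  have R0: "0 \<le> R" using R[OF z] zero_le_dist[of x\<^sub>0 z] by linarith
  let ?d = "\<lambda>n x. \<bar>(P ^^ n) \<phi> x - (\<integral>y. \<phi> y \<partial>\<mu>)\<bar>"
  show "(\<lambda>n. SUP x\<in>K. ?d n x) \<longlonglongrightarrow> 0"
  proof (rule LIMSEQ_I)
    fix e :: real assume e: "0 < e"
    then have "0 < e / 2" by simp
    then obtain n\<^sub>0 where n\<^sub>0: "\<And>n x. n\<^sub>0 \<le> n \<Longrightarrow> V x \<le> R \<Longrightarrow> ?d n x \<le> e / 2"
      using bounded_convergence[OF mu rep \<phi>(1) B R0] by blast
    have "norm ((SUP x\<in>K. ?d n x) - 0) < e" if n: "n\<^sub>0 \<le> n" for n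
    proof -
      have d: "?d n x \<le> e / 2" if "x \<in> K" for x
        using n\<^sub>0[OF n] R[OF that] by (simp add: dist_commute)
      have "(SUP x\<in>K. ?d n x) \<le> e / 2" using K d by (intro cSUP_least) auto
      \<comment> \<open>A member of the family bounds the supremum below by a nonnegative number,
        which the norm requires.\<close>
      moreover have "?d n z \<le> (SUP x\<in>K. ?d n x)"
        using d by (intro cSUP_upper z bdd_aboveI2)
      ultimately show ?thesis using e by simp
    qed
    then show "\<exists>n\<^sub>0. \<forall>n\<ge>n\<^sub>0. norm ((SUP x\<in>K. ?d n x) - 0) < e" by blast
  qed
qed

end

section \<open>Uniqueness of the limit and conclusion\<close>

lemma blip_in_bcontfun: "f \<in> blip \<Longrightarrow> f \<in> bcontfun"
  using blip_bounded[of f] blip_continuous[of f] by (auto simp: bcontfun_def bounded_iff)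

text \<open>The orbit of a stationary measure is constant, so this turns attraction into
  uniqueness.\<close>

lemma weakly_converges_const:
  fixes \<mu> \<nu> :: "'a::metric_space measure"
  assumes "\<mu> \<in> borel_prob" "\<nu> \<in> borel_prob" "weakly_converges (\<lambda>n. \<nu>) \<mu>"
  shows "\<nu> = \<mu>"
proof (rule borel_prob_eqI[OF assms(2,1)])
  fix f :: "'a \<Rightarrow> real" assume "f \<in> blip"
  then have "(\<lambda>n::nat. \<integral>x. f x \<partial>\<nu>) \<longlonglongrightarrow> (\<integral>x. f x \<partial>\<mu>)"
    using assms(3) blip_in_bcontfun by (auto simp: weakly_converges_def)
  then show "(\<integral>x. f x \<partial>\<nu>) = (\<integral>x. f x \<partial>\<mu>)" by (simp add: LIMSEQ_const_iff)
qed

text \<open>A singleton is compact, so both hypotheses give limits of the same real sequence at one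
  point, here the arbitrary \<open>undefined\<close>.\<close>

lemma weakly_converges_unif_compacts_unique:
  fixes \<mu> \<nu> :: "'a::metric_space measure"
  assumes "\<mu> \<in> borel_prob" "\<nu> \<in> borel_prob"
    and "weakly_converges_unif_compacts P \<mu>" "weakly_converges_unif_compacts P \<nu>"
  shows "\<mu> = \<nu>"
proof (rule borel_prob_eqI[OF assms(1,2)])
  fix f :: "'a \<Rightarrow> real" assume f: "f \<in> blip"
  have "(\<lambda>n. (P ^^ n) f undefined) \<longlonglongrightarrow> (\<integral>x. f x \<partial>\<rho>)" if "weakly_converges_unif_compacts P \<rho>" for \<rho>
  proof -
    have "(\<lambda>n. SUP x\<in>{undefined}. \<bar>(P ^^ n) f x - (\<integral>y. f y \<partial>\<rho>)\<bar>) \<longlonglongrightarrow> 0"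
      using that[unfolded weakly_converges_unif_compacts_def, rule_format, of "{undefined}" f]
        blip_in_bcontfun[OF f] by simp
    then show ?thesis by (simp add: tendsto_rabs_zero_iff LIM_zero_iff)
  qed
  from LIMSEQ_unique[OF this[OF assms(3)] this[OF assms(4)]]
  show "(\<integral>x. f x \<partial>\<mu>) = (\<integral>x. f x \<partial>\<nu>)" .
qed

theorem theorem4p6:
  fixes w :: "nat \<Rightarrow> 'a::complete_space \<Rightarrow> 'a"
    and p :: "nat \<Rightarrow> 'a \<Rightarrow> real"
    and N k :: nat
    and r \<omega> :: "real \<Rightarrow> real"
    and x\<^sub>0 :: 'a
  assumes "ifs N w p"
    and "(r, \<omega>) \<in> couples"
    and "concave_on {0..} r" and "concave_on {0..} \<omega>"
    and "\<And>x y. (\<Sum>i=1..N. p i x * dist (w i x) (w i y)) \<le> r (dist x y)"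
    and "\<And>x y. (\<Sum>i=1..N. \<bar>p i x - p i y\<bar>) \<le> \<omega> (dist x y)"
    and "(MIN i\<in>{1..N}. p i x\<^sub>0) > 0"
    and "k \<in> {1..N}"
    and "\<exists>c<1. c-lipschitz_on UNIV (w k)"
    and "(INF x. p k x) > 0"
  shows "asymptotically_stable (trans_op N w p) \<and>
    (\<exists>\<mu>\<^sub>s\<in>borel_prob. dual_op (trans_op N w p) \<mu>\<^sub>s = \<mu>\<^sub>s \<and>
       weakly_converges_unif_compacts (trans_op N w p) \<mu>\<^sub>s \<and>
       (\<forall>\<nu>\<in>borel_prob. weakly_converges_unif_compacts (trans_op N w p) \<nu> \<longrightarrow> \<nu> = \<mu>\<^sub>s))"
proof -
  obtain c where c: "c < 1" "c-lipschitz_on UNIV (w k)" using assms(9) by blast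
  \<comment> \<open>\<open>INF\<close> on the reals is a lower bound only for sets bounded below;
    nonnegativity of \<open>p k\<close> ensures this.\<close>
  have bdd: "bdd_below (range (p k))"
    using assms(1,8) by (intro bdd_belowI[of _ 0]) (auto simp: ifs_def)
  \<comment> \<open>The infimum of \<open>p k\<close> plays the role of \<open>\<delta>\<close>, and
    \<open>x\<^sub>0\<close> is the base point of \<open>V\<close>.\<close>
  interpret contractive_ifs N w p r \<omega> k c "INF x. p k x" x\<^sub>0
  proof
    show "0 \<le> c" using c(2) by (rule lipschitz_on_nonneg)
    show "dist (w k x) (w k y) \<le> c * dist x y" for x y using lipschitz_onD[OF c(2)] by simp
    show "(INF x. p k x) \<le> p k x" for x by (rule cINF_lower[OF bdd]) simp
  qed (use assms c(1) in simp_all)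
  interpret lm: smooth_blip_mean limit_mean
    by (rule smooth_blip_mean_if_tight[OF blip_mean_limit_mean limit_mean_tight])
  have mu: "lm.rep \<in> borel_prob" by (rule lm.rep_borel_prob)
  have attracts: "weakly_converges (\<lambda>n. (dual_op P ^^ n) \<nu>) lm.rep" if "\<nu> \<in> borel_prob" for \<nu>
    by (rule limit_measure_attracts[OF mu lm.integral_rep that])
  have stationary: "dual_op P lm.rep = lm.rep"
    by (rule limit_measure_stationary[OF mu lm.integral_rep])
  have unif: "weakly_converges_unif_compacts P lm.rep"
    by (rule limit_measure_unif_compacts[OF mu lm.integral_rep])
  have unique: "\<nu> = lm.rep" if nu: "\<nu> \<in> borel_prob" and "dual_op P \<nu> = \<nu>" for \<nu>
  proof -
    have "(dual_op P ^^ n) \<nu> = \<nu>" for n by (induction n) (simp_all add: that)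
    with attracts[OF nu] show ?thesis by (intro weakly_converges_const mu nu) simp
  qed
  have "asymptotically_stable P"
    unfolding asymptotically_stable_def
    by (intro bexI[of _ lm.rep] conjI ballI impI mu stationary unique attracts)
  moreover have "\<forall>\<nu>\<in>borel_prob. weakly_converges_unif_compacts P \<nu> \<longrightarrow> \<nu> = lm.rep"
    by (intro ballI impI weakly_converges_unif_compacts_unique[OF _ mu _ unif])
  ultimately show ?thesis by (intro conjI bexI[of _ lm.rep] mu stationary unif)
qed

end
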